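(* Let $0<\delta<1$ and $M>0$ be constants. For each $n$, let $\mathbb{T}=\mathbb{T}_n$ be a packing torus of $B_2^n$ with $\operatorname{vol}(\mathbb{T})\le M^n\nu_n$, and let $\mathbf{X}\subseteq\mathbb{T}$ be sampled from the Poisson point process on $\mathbb{T}$ with intensity \[ \rho=\Big(\tfrac12+\delta\Big)\frac{n\ln n}{\nu_n}. \] Then the probability that all of the following hold tends to $1$ as $n\to\infty$: (i) $\mathbb{T}\subseteq\mathbf{X}+B_1^n$; (ii) $\vartheta(\mathbf{X},\mathbb{T})\le(\tfrac12+2\delta)\,n\ln n$; (iii) $\mu(\mathbf{X})\le(\xi+10\delta)\,n\ln n$, where $\xi=1.79556\ldots$ is the unique positive real root of $\ln\!\left(\frac{2x}{\mathrm{e}}\right)=\frac{1}{2x}$.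
   Context: $B_r^n$ is the closed Euclidean ball of radius $r$ centred at the origin of $\mathbb{R}^n$ and $\nu_n=\operatorname{vol}(B_1^n)$. A lattice $\Lambda\subseteq\mathbb{R}^n$ is the set of integer combinations of $n$ linearly independent vectors. For a convex body $K$ (compact convex set with nonempty interior), $\Lambda$ is a packing lattice of $K$ if the translates $K+\mathbf{p}$, $\mathbf{p}\in\Lambda$, are pairwise disjoint; then $\mathbb{T}=\mathbb{R}^n/\Lambda$ is called a packing torus of $K$. The volume on $\mathbb{T}$ is the Lebesgue measure transferred from a fundamental domain of $\Lambda$; sets in $\mathbb{R}^n$ are identified with their images in $\mathbb{T}$, e.g. $\mathbf{X}+B_1^n$ is the image in $\mathbb{T}$ of $\{\mathbf{x}+\mathbf{y}:\mathbf{x}\in\mathbf{X},\mathbf{y}\in B_1^n\}$. The distance $\|\mathbf{x}-\mathbf{y}\|$ between points of $\mathbb{T}$ is the distance between their preimage sets in $\mathbb{R}^n$. A random set $\mathbf{X}\subseteq\mathbb{T}$ is sampled from the Poisson point process with intensity $\rho$ if for every measurable $S\subseteq\mathbb{T}$, $|\mathbf{X}\cap S|$ is Poisson with mean $\rho\operatorname{vol}(S)$, and counts in disjoint sets are independent. Here $\vartheta(\mathbf{X},\mathbb{T})=\sum_{\mathbf{x}\in\mathbf{X}}\operatorname{vol}(B_1^n(\mathbf{x})\cap\mathbb{T})/\operatorname{vol}(\mathbb{T})=|\mathbf{X}|\nu_n/\operatorname{vol}(\mathbb{T})$, and $\mu(\mathbf{X})=\sup_{\mathbf{u}\in\mathbb{T}}|\{\mathbf{x}\in\mathbf{X}:\|\mathbf{u}-\mathbf{x}\|\le1\}|$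 is the maximum number of translates $\mathbf{x}+B_1^n$ covering a point. *)

theory Defs
  imports "HOL-Probability.Probability"
begin

text \<open>Since the dimension tends to infinity, \<open>\<real>\<^sup>n\<close> cannot be a type. It is represented by the
  functions \<open>nat \<Rightarrow> real\<close> that are extensional on \<open>{..<n}\<close>, with Lebesgue measure given on the
  Borel sets by the \<open>n\<close>-fold product of \<open>lborel\<close>.\<close>

type_synonym nvec = "nat \<Rightarrow> real"

definition leb :: "nat \<Rightarrow> nvec measure" where
  "leb n = (\<Pi>\<^sub>M i\<in>{..<n}. lborel)"

definition Rn :: "nat \<Rightarrow> nvec set" where
  "Rn n = ({..<n} \<rightarrow>\<^sub>E UNIV)"

definition vplus :: "nat \<Rightarrow> nvec \<Rightarrow> nvec \<Rightarrow> nvec" where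
  "vplus n x y = (\<lambda>i\<in>{..<n}. x i + y i)"

definition nnorm :: "nat \<Rightarrow> nvec \<Rightarrow> real" where
  "nnorm n x = L2_set x {..<n}"

definition ndist :: "nat \<Rightarrow> nvec \<Rightarrow> nvec \<Rightarrow> real" where
  "ndist n x y = nnorm n (\<lambda>i\<in>{..<n}. x i - y i)"

definition nball :: "nat \<Rightarrow> real \<Rightarrow> nvec set" where
  "nball n r = {x \<in> Rn n. nnorm n x \<le> r}"

definition nu :: "nat \<Rightarrow> real" where
  "nu n = measure (leb n) (nball n 1)"

definition lin_indep :: "nat \<Rightarrow> (nat \<Rightarrow> nvec) \<Rightarrow> bool" where
  "lin_indep n b \<longleftrightarrow>
     (\<forall>c :: nat \<Rightarrow> real. (\<forall>j<n. (\<Sum>i<n. c i * b i j) = 0) \<longrightarrow> (\<forall>i<n. c i = 0))"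

definition lattice_of :: "nat \<Rightarrow> (nat \<Rightarrow> nvec) \<Rightarrow> nvec set" where
  "lattice_of n b = range (\<lambda>k :: nat \<Rightarrow> int. \<lambda>j\<in>{..<n}. \<Sum>i<n. of_int (k i) * b i j)"

definition is_lattice :: "nat \<Rightarrow> nvec set \<Rightarrow> bool" where
  "is_lattice n \<Lambda> \<longleftrightarrow>
     (\<exists>b. (\<forall>i<n. b i \<in> Rn n) \<and> lin_indep n b \<and> \<Lambda> = lattice_of n b)"

text \<open>In the following definition \<open>K\<close> is meant to be a convex body.\<close>

definition packing_lattice :: "nat \<Rightarrow> nvec set \<Rightarrow> nvec set \<Rightarrow> bool" where
  "packing_lattice n K \<Lambda> \<longleftrightarrow>
     is_lattice n \<Lambda> \<and> disjoint_family_on (\<lambda>p. (\<lambda>x. vplus n x p) ` K) \<Lambda>"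

text \<open>A point of the torus \<open>\<real>\<^sup>n / \<Lambda>\<close> is a coset, that is, the set of its preimages in \<open>\<real>\<^sup>n\<close>.\<close>

definition tproj :: "nat \<Rightarrow> nvec set \<Rightarrow> nvec \<Rightarrow> nvec set" where
  "tproj n \<Lambda> x = vplus n x ` \<Lambda>"

definition torus :: "nat \<Rightarrow> nvec set \<Rightarrow> nvec set set" where
  "torus n \<Lambda> = tproj n \<Lambda> ` Rn n"

definition tdist :: "nat \<Rightarrow> nvec set \<Rightarrow> nvec set \<Rightarrow> real" where
  "tdist n u v = (INF (x, y) \<in> u \<times> v. ndist n x y)"

text \<open>The image in the torus of the Minkowski sum of a subset \<open>A\<close> of the torus, identified
  with the set \<open>\<Union>A\<close> of all preimages of its points, and a subset \<open>B\<close> of \<open>\<real>\<^sup>n\<close>.\<close>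

definition tsum :: "nat \<Rightarrow> nvec set \<Rightarrow> nvec set set \<Rightarrow> nvec set \<Rightarrow> nvec set set" where
  "tsum n \<Lambda> A B = tproj n \<Lambda> ` {vplus n x y | x y. x \<in> \<Union>A \<and> y \<in> B}"

definition is_fundamental_domain :: "nat \<Rightarrow> nvec set \<Rightarrow> nvec set \<Rightarrow> bool" where
  "is_fundamental_domain n \<Lambda> F \<longleftrightarrow> F \<in> sets (leb n) \<and> (\<forall>u\<in>torus n \<Lambda>. \<exists>!x. x \<in> F \<inter> u)"

definition fundamental_domain :: "nat \<Rightarrow> nvec set \<Rightarrow> nvec set" where
  "fundamental_domain n \<Lambda> = (SOME F. is_fundamental_domain n \<Lambda> F)"

text \<open>Lebesgue measure on the torus: the measurable sets are those with Borel preimage in \<open>\<real>\<^sup>n\<close>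
  (the preimage of \<open>A\<close> is \<open>\<Union>A\<close>). For a lattice the measure does not depend on the choice of the
  fundamental domain.\<close>

definition torus_measure :: "nat \<Rightarrow> nvec set \<Rightarrow> nvec set measure" where
  "torus_measure n \<Lambda> =
     distr (restrict_space (leb n) (fundamental_domain n \<Lambda>))
       (sigma (torus n \<Lambda>) {A. A \<subseteq> torus n \<Lambda> \<and> \<Union>A \<in> sets (leb n)})
       (tproj n \<Lambda>)"

text \<open>The number of elements of a set, in \<open>[0, \<infinity>]\<close>. In contrast to \<open>card\<close> it is infinite for
  infinite sets.\<close>

definition ecount :: "'a set \<Rightarrow> ennreal" where
  "ecount A = emeasure (count_space UNIV) A"

text \<open>\<open>X\<close> is a random subset of \<open>space N\<close>, defined on the probability space \<open>P\<close>, whose counts are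
  Poisson distributed with mean \<open>\<rho>\<close> times the \<open>N\<close>-volume, and are independent for disjoint sets.
  The measure \<open>N\<close> is meant to be finite. The point probabilities are written out because
  \<^const>\<open>poisson_pmf\<close> is only specified for a positive rate; here the rate may be \<open>0\<close>
  (and then the count is almost surely \<open>0\<close>, since \<open>0 ^ 0 = 1\<close>).\<close>

definition poisson_process ::
  "'w measure \<Rightarrow> 'a measure \<Rightarrow> real \<Rightarrow> ('w \<Rightarrow> 'a set) \<Rightarrow> bool" where
  "poisson_process P N \<rho> X \<longleftrightarrow>
     prob_space P \<and>
     (\<forall>\<omega>\<in>space P. X \<omega> \<subseteq> space N) \<and>
     (\<forall>S\<in>sets N.
        (\<lambda>\<omega>. ecount (X \<omega> \<inter> S)) \<in> borel_measurable P \<and>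
        (\<forall>k::nat. measure P {\<omega>\<in>space P. ecount (X \<omega> \<inter> S) = of_nat k} =
           (\<rho> * measure N S) ^ k / fact k * exp (- (\<rho> * measure N S)))) \<and>
     (\<forall>(I :: nat set) S. finite I \<longrightarrow> (\<forall>i\<in>I. S i \<in> sets N) \<longrightarrow> disjoint_family_on S I \<longrightarrow>
        prob_space.indep_vars P (\<lambda>_. borel) (\<lambda>i \<omega>. ecount (X \<omega> \<inter> S i)) I)"

definition cover_density :: "nat \<Rightarrow> nvec set \<Rightarrow> nvec set set \<Rightarrow> ennreal" where
  "cover_density n \<Lambda> A =
     (\<integral>\<^sup>+ x. emeasure (torus_measure n \<Lambda>) (tsum n \<Lambda> {x} (nball n 1))
          / emeasure (torus_measure n \<Lambda>) (torus n \<Lambda>) \<partial>count_space A)"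

definition max_mult :: "nat \<Rightarrow> nvec set \<Rightarrow> nvec set set \<Rightarrow> ennreal" where
  "max_mult n \<Lambda> A = (SUP u\<in>torus n \<Lambda>. ecount {x \<in> A. tdist n u x \<le> 1})"

definition xi :: real where
  "xi = (THE x. x > 0 \<and> ln (2 * x / exp 1) = 1 / (2 * x))"

lemma exp_lower_bound:
  fixes x q :: real
  assumes "0 \<le> q" "q \<le> (\<Sum>m<6. x ^ m / fact m)"
  shows "q ^ 16 \<le> exp (16 * x)"
proof -
  obtain t where "exp x = (\<Sum>m<6. x ^ m / fact m) + exp t / fact 6 * x ^ 6"
    using Maclaurin_exp_le[of x 6] by blast
  moreover have "exp t / fact 6 * x ^ 6 \<ge> 0"
    by (intro mult_nonneg_nonneg) (auto simp: zero_le_even_power)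
  ultimately have "q \<le> exp x" using assms(2) by linarith
  then have "q ^ 16 \<le> exp x ^ 16" using assms(1) by (intro power_mono)
  also have "\<dots> = exp (16 * x)" by (simp flip: exp_of_nat_mult)
  finally show ?thesis .
qed

lemma xi_unique_root:
  shows xi_ex1: "\<exists>!x::real. x > 0 \<and> ln (2 * x / exp 1) = 1 / (2 * x)"
    and xi_bounds: "1.79556 \<le> xi" "xi < 1.79557"
proof -
  define g :: "real \<Rightarrow> real" where "g x = ln (2 * x / exp 1) - 1 / (2 * x)" for x
  have mono: "g x < g y" if "0 < x" "x < y" for x y
  proof -
    have "ln (2 * x / exp 1) < ln (2 * y / exp 1)"
      using that by (subst ln_less_cancel_iff) (auto simp: divide_strict_right_mono)
    moreover have "1 / (2 * y) < 1 / (2 * x)"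
      using that by (simp add: frac_less2)
    ultimately show ?thesis by (simp add: g_def)
  qed
  have g_eq: "g x = ln (2 * x) - 1 - 1 / (2 * x)" if "x > 0" for x
    using that by (simp add: g_def ln_div)
  have lo: "g 1.79556 \<le> 0"
  proof -
    have "(3.59112::real) \<le> 1.083183117 ^ 16"
      by (simp add: power_divide)
    also have "\<dots> \<le> exp (16 * 0.0799040375)"
      by (rule exp_lower_bound) (simp_all add: lessThan_nat_numeral lessThan_Suc fact_numeral power_divide)
    finally have "ln (3.59112::real) \<le> ln (exp (16 * 0.0799040375))"
      by (subst ln_le_cancel_iff) auto
    then show ?thesis by (subst g_eq) auto
  qed
  have hi: "g 1.79557 > 0"
  proof -
    have "(1/3.59114::real) < 0.923205015 ^ 16"
      by (simp add: power_divide)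
    also have "\<dots> \<le> exp (16 * (- 0.07990395))"
      by (rule exp_lower_bound) (simp_all add: lessThan_nat_numeral lessThan_Suc fact_numeral power_divide)
    finally have "ln (1/3.59114::real) < ln (exp (16 * (- 0.07990395)))"
      by (subst ln_less_cancel_iff) auto
    moreover have "ln (1/3.59114::real) = - ln 3.59114"
      by (subst ln_div) auto
    ultimately show ?thesis by (subst g_eq) auto
  qed
  have cont: "continuous_on {1.79556..1.79557} g"
    unfolding g_def by (intro continuous_intros) auto
  obtain x where x: "1.79556 \<le> x" "x \<le> 1.79557" "g x = 0"
    using IVT'[of g "1.79556" 0 "1.79557"] lo hi cont by force
  have root: "x > 0 \<and> ln (2 * x / exp 1) = 1 / (2 * x)"
    using x by (simp add: g_def)
  have uniq: "y = x" if "y > 0 \<and> ln (2 * y / exp 1) = 1 / (2 * y)" for y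
  proof -
    have "g y = 0" using that by (simp add: g_def)
    then show ?thesis
      using mono[of x y] mono[of y x] that x by (cases x y rule: linorder_cases) auto
  qed
  show "\<exists>!x::real. x > 0 \<and> ln (2 * x / exp 1) = 1 / (2 * x)"
    using root uniq by blast
  have "xi = x" unfolding xi_def using root uniq by (rule the_equality)
  moreover have "x \<noteq> 1.79557"
  proof
    assume "x = 1.79557"
    then have "g 1.79557 = 0" using x(3) by (simp only:)
    with hi show False by (simp only: less_irrefl)
  qed
  ultimately show "1.79556 \<le> xi" "xi < 1.79557"
    using x(1,2) by (simp_all only: less_le simp_thms)
qed

end

theory Submission
  imports Defs "HOL-Real_Asymp.Real_Asymp"
begin

text \<open>
  Write \<open>L = n ln n\<close>. All three properties follow from Chernoff bounds and union bounds over
  finite nets of the torus; a net of scale \<open>s\<close> has at most \<open>(2M / s)\<^sup>n\<close> points, which is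
  \<open>exp (L + O(n))\<close> for \<open>s\<close> of order \<open>1 / n\<close> and \<open>exp (L / 2 + O(n))\<close> for \<open>s\<close> of order
  \<open>1 / sqrt n\<close>. For the multiplicity, one takes a fine net (scale \<open>1 / n\<close>) and bounds the number of
  points in slightly enlarged unit balls; the equation for \<open>\<xi>\<close> makes the exponent of the Chernoff bound
  with parameter \<open>2 \<xi>\<close> equal to \<open>-L\<close> at intensity \<open>1 / 2\<close>.

  A fine net alone would only give coverings of density \<open>L\<close>. For density \<open>L / 2\<close>, one first shows with a
  coarse net (scale \<open>1 / sqrt n\<close>) that each ball of radius \<open>1 - O(1 / n)\<close> around a point \<open>u\<close> of the
  net contains at least \<open>\<kappa> L\<close> points of \<open>X\<close>, for some small constant \<open>\<kappa>\<close>. If a point \<open>z\<close> of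
  the fine net with \<open>\<parallel>z - u\<parallel> = O(1 / sqrt n)\<close> is not covered, then all of these points lie in the difference
  of two balls, whose volume is an arbitrarily small fraction \<open>exp (- D)\<close> of the volume of the unit ball; the
  probability of this is \<open>exp (- \<kappa> D L + O(L))\<close>, which beats the number of pairs \<open>(u, z)\<close>.

  The probability space need not be complete, so the event itself has to be shown to be
  measurable. When the density is finite, \<open>X\<close> is finite, and compactness allows one to express covering and
  multiplicity through counts in balls with rational centres.
\<close>

subsection \<open>Vectors and Lebesgue measure\<close>

text \<open>Factor 0 gives the zero vector, factor - 1 the negative, and factor 1 turns an arbitrary
  function into the element of \<open>Rn n\<close> with the same first \<open>n\<close>
  coordinates.\<close>

definition vscale :: "nat \<Rightarrow> real \<Rightarrow> nvec \<Rightarrow> nvec" where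
  "vscale n c x = (\<lambda>i\<in>{..<n}. c * x i)"

text \<open>The centre may be any function, since \<open>ndist\<close> reads only the coordinates
  below \<open>n\<close>; formulas for centres can thus be written without
  \<open>restrict\<close>.\<close>

definition nball_at :: "nat \<Rightarrow> nvec \<Rightarrow> real \<Rightarrow> nvec set" where
  "nball_at n x r = {y \<in> Rn n. ndist n x y \<le> r}"

lemma vplus_in_Rn [simp, intro]: "vplus n x y \<in> Rn n"
  by (simp add: vplus_def Rn_def)

lemma vscale_in_Rn [simp, intro]: "vscale n c x \<in> Rn n"
  by (simp add: vscale_def Rn_def)

lemma vscale_apply [simp]: "i < n \<Longrightarrow> vscale n c x i = c * x i"
  by (simp add: vscale_def)

lemma Rn_eqI: "x = y" if "x \<in> Rn n" "y \<in> Rn n" "\<And>i. i < n \<Longrightarrow> x i = y i"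
  using that unfolding Rn_def by (intro PiE_ext) auto

lemma Rn_undefined: "x \<in> Rn n \<Longrightarrow> \<not> i < n \<Longrightarrow> x i = undefined"
  by (auto simp: Rn_def PiE_iff extensional_def)

lemma vplus_apply [simp]: "i < n \<Longrightarrow> vplus n x y i = x i + y i"
  by (simp add: vplus_def)

lemma vplus_assoc: "vplus n (vplus n x y) z = vplus n x (vplus n y z)"
  by (rule Rn_eqI) (auto simp: add.assoc)

lemma vplus_cancel: "vplus n x p = vplus n x q \<longleftrightarrow> p = q" if "p \<in> Rn n" "q \<in> Rn n"
proof
  assume "vplus n x p = vplus n x q"
  then have "x i + p i = x i + q i" if "i < n" for i using that by (metis vplus_apply)
  then show "p = q" using that by (intro Rn_eqI) auto
qed simp

lemma vplus_zero: "vplus n x (vscale n 0 y) = x" if "x \<in> Rn n"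
  using that by (intro Rn_eqI) auto

lemma vplus_inverse: "vplus n (vplus n x p) (vscale n (- 1) p) = x" 
  "vplus n (vplus n x (vscale n (- 1) p)) p = x" if "x \<in> Rn n"
  using that by (auto intro!: Rn_eqI)

lemma ndist_eq: "ndist n x y = L2_set (\<lambda>i. x i - y i) {..<n}"
  unfolding ndist_def nnorm_def by (rule L2_set_cong) auto

lemma ndist_nonneg [simp]: "0 \<le> ndist n x y"
  by (simp add: ndist_eq)

lemma ndist_power2: "(ndist n x y)\<^sup>2 = (\<Sum>i<n. (x i - y i)\<^sup>2)"
  by (simp add: ndist_eq L2_set_def sum_nonneg)

lemma ndist_cong: "(\<And>i. i < n \<Longrightarrow> \<bar>x i - y i\<bar> = \<bar>x' i - y' i\<bar>) \<Longrightarrow> ndist n x y = ndist n x' y'"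
  unfolding ndist_eq L2_set_def
  by (intro arg_cong[where f = sqrt] sum.cong refl) (metis lessThan_iff power2_abs)

lemma ndist_commute: "ndist n x y = ndist n y x"
  by (rule ndist_cong) auto

lemma ndist_self [simp]: "ndist n x x = 0"
  by (simp add: ndist_eq L2_set_def)

lemma ndist_triangle: "ndist n x z \<le> ndist n x y + ndist n y z"
  using L2_set_triangle_ineq[of "\<lambda>i. x i - y i" "\<lambda>i. y i - z i" "{..<n}"]
  by (simp add: ndist_eq)

lemma ndist_vplus: "ndist n (vplus n x p) (vplus n y p) = ndist n x y"
  by (rule ndist_cong) auto

lemma ndist_vplus_same: "ndist n (vplus n x p) (vplus n x q) = ndist n p q"
  by (rule ndist_cong) auto

lemma ndist_vplus_uminus: "ndist n (vplus n x p) y = ndist n x (vplus n y (vscale n (- 1) p))"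
  by (rule ndist_cong) auto

lemma nball_eq: "nball n r = nball_at n (vscale n 0 p) r"
proof -
  have "nnorm n x = ndist n (vscale n 0 p) x" for x
    unfolding ndist_eq nnorm_def L2_set_def by auto
  then show ?thesis by (auto simp: nball_def nball_at_def)
qed

lemma nball_at_subset_Rn: "nball_at n x r \<subseteq> Rn n"
  by (auto simp: nball_at_def)

lemma vplus_image_nball_at:
  assumes "p \<in> Rn n"
  shows "(\<lambda>y. vplus n y p) ` nball_at n x r = nball_at n (vplus n x p) r"
proof (intro equalityI subsetI)
  fix y assume "y \<in> nball_at n (vplus n x p) r"
  then show "y \<in> (\<lambda>y. vplus n y p) ` nball_at n x r"
    by (intro image_eqI[of _ _ "vplus n y (vscale n (- 1) p)"])
       (auto simp: nball_at_def vplus_inverse ndist_vplus_uminus[symmetric])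
qed (auto simp: nball_at_def ndist_vplus)

lemma space_leb [simp]: "space (leb n) = Rn n"
  by (simp add: leb_def space_PiM Rn_def)

lemma ndist_measurable [measurable]: "(\<lambda>y. ndist n x y) \<in> borel_measurable (leb n)"
  unfolding ndist_eq L2_set_def leb_def by measurable

lemma nball_at_measurable [measurable]: "nball_at n x r \<in> sets (leb n)"
proof -
  have "nball_at n x r = {y \<in> space (leb n). ndist n x y \<le> r}"
    by (auto simp: nball_at_def)
  also have "\<dots> \<in> sets (leb n)" by measurable
  finally show ?thesis .
qed

lemma vplus_measurable [measurable]: "(\<lambda>y. vplus n y p) \<in> leb n \<rightarrow>\<^sub>M leb n"
  unfolding vplus_def leb_def by measurable

text \<open>A product measure is determined by its values on boxes, and translating a box shifts
  each side separately. This reduces the claim to translation invariance of \<open>lborel\<close> on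
  the line.\<close>

lemma distr_vplus_leb: "distr (leb n) (leb n) (\<lambda>y. vplus n y p) = leb n"
proof -
  interpret product_sigma_finite "\<lambda>_::nat. lborel :: real measure"
    by standard
  show ?thesis
    unfolding leb_def
  proof (rule PiM_eqI)
    fix A :: "nat \<Rightarrow> real set" assume A: "\<And>i. i \<in> {..<n} \<Longrightarrow> A i \<in> sets lborel"
    define B where "B i = (\<lambda>x. x + p i) -` A i" for i
    have B: "B i \<in> sets lborel" if "i < n" for i
    proof -
      have "(\<lambda>x. x + p i) -` A i \<inter> space lborel \<in> sets lborel"
        using A[of i] that by (intro measurable_sets[where A = lborel]) auto
      then show ?thesis by (simp add: B_def)
    qed
    have "emeasure (distr (Pi\<^sub>M {..<n} (\<lambda>_. lborel)) (Pi\<^sub>M {..<n} (\<lambda>_. lborel)) (\<lambda>y. vplus n y p)) (Pi\<^sub>E {..<n} A)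
       = emeasure (Pi\<^sub>M {..<n} (\<lambda>_. lborel)) ((\<lambda>y. vplus n y p) -` Pi\<^sub>E {..<n} A \<inter> Rn n)"
      using vplus_measurable[of n p] A
      by (subst emeasure_distr) (auto simp: leb_def space_PiM Rn_def)
    also have "(\<lambda>y. vplus n y p) -` Pi\<^sub>E {..<n} A \<inter> Rn n = Pi\<^sub>E {..<n} B"
    proof (rule set_eqI)
      fix y
      show "y \<in> (\<lambda>y. vplus n y p) -` Pi\<^sub>E {..<n} A \<inter> Rn n \<longleftrightarrow> y \<in> Pi\<^sub>E {..<n} B"
        by (simp add: Rn_def vplus_def B_def PiE_iff)
    qed
    also have "emeasure (Pi\<^sub>M {..<n} (\<lambda>_. lborel)) \<dots> = (\<Prod>i\<in>{..<n}. emeasure lborel (B i))"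
      using B by (intro emeasure_PiM) auto
    also have "\<dots> = (\<Prod>i\<in>{..<n}. emeasure lborel (A i))"
    proof (intro prod.cong refl)
      fix i assume i: "i \<in> {..<n}"
      have "emeasure lborel (A i) = emeasure (distr lborel borel ((+) (p i))) (A i)"
        by (simp add: lborel_distr_plus)
      also have "\<dots> = emeasure lborel (B i)"
        using A[OF i] by (subst emeasure_distr) (auto simp: B_def vimage_def add.commute[of "p i"])
      finally show "emeasure lborel (B i) = emeasure lborel (A i)" by simp
    qed
    finally show "emeasure (distr (Pi\<^sub>M {..<n} (\<lambda>_. lborel)) (Pi\<^sub>M {..<n} (\<lambda>_. lborel)) (\<lambda>y. vplus n y p))
        (Pi\<^sub>E {..<n} A) = (\<Prod>i\<in>{..<n}. emeasure lborel (A i))" .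
  qed auto
qed

lemma vplus_image_eq_vimage:
  assumes "S \<subseteq> Rn n"
  shows "(\<lambda>y. vplus n y p) ` S = (\<lambda>y. vplus n y (vscale n (- 1) p)) -` S \<inter> Rn n"
proof (intro equalityI subsetI)
  fix y assume y: "y \<in> (\<lambda>y. vplus n y (vscale n (- 1) p)) -` S \<inter> Rn n"
  then have "y = vplus n (vplus n y (vscale n (- 1) p)) p"
    by (simp add: vplus_inverse)
  with y show "y \<in> (\<lambda>y. vplus n y p) ` S" by blast
qed (use assms in \<open>auto simp: vplus_inverse\<close>)

lemma vplus_image_measurable:
  assumes "S \<in> sets (leb n)"
  shows "(\<lambda>y. vplus n y p) ` S \<in> sets (leb n)"
  using measurable_sets[OF vplus_measurable assms] sets.sets_into_space[OF assms]
  by (subst vplus_image_eq_vimage) auto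

lemma emeasure_vplus_image:
  assumes "S \<in> sets (leb n)"
  shows "emeasure (leb n) ((\<lambda>y. vplus n y p) ` S) = emeasure (leb n) S"
proof -
  have "emeasure (leb n) S = emeasure (distr (leb n) (leb n) (\<lambda>y. vplus n y (vscale n (- 1) p))) S"
    by (simp add: distr_vplus_leb)
  also have "\<dots> = emeasure (leb n) ((\<lambda>y. vplus n y p) ` S)"
    using assms sets.sets_into_space[OF assms]
    by (subst emeasure_distr) (auto simp: vplus_image_eq_vimage)
  finally show ?thesis by simp
qed

lemma emeasure_nball_at_unit_ball_vol:
  assumes "r > 0"
  shows "emeasure (leb n) (nball_at n x r) = ennreal (unit_ball_vol n * r ^ n)"
proof -
  have "nball n r = {f. sqrt (\<Sum>i\<in>{..<n}. (f i)\<^sup>2) \<le> r} \<inter> space (Pi\<^sub>M {..<n} (\<lambda>_. lborel))"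
    by (auto simp: nball_def nnorm_def L2_set_def space_PiM Rn_def)
  then have "emeasure (leb n) (nball n r) = ennreal (unit_ball_vol n * r ^ n)"
    using emeasure_cball_aux[of "{..<n}" r] assms by (simp add: leb_def)
  \<comment> \<open>The function \<open>x\<close> may lie outside \<open>Rn n\<close>, so the
    translation is by \<open>vscale n 1 x\<close>, which has the same distances to all
    points.\<close>
  moreover have "(\<lambda>y. vplus n y (vscale n 1 x)) ` nball n r = nball_at n x r"
  proof -
    have "vplus n (vscale n 0 x) (vscale n 1 x) = vscale n 1 x"
      by (rule Rn_eqI) auto
    moreover have "ndist n (vscale n 1 x) y = ndist n x y" for y
      by (rule ndist_cong) auto
    ultimately show ?thesis
      unfolding nball_eq[of n r x] by (simp add: vplus_image_nball_at) (simp add: nball_at_def)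
  qed
  moreover have "nball n r \<in> sets (leb n)"
    unfolding nball_eq[of n r x] by (rule nball_at_measurable)
  ultimately show ?thesis
    using emeasure_vplus_image[of "nball n r" n "vscale n 1 x"] by simp
qed

subsection \<open>Lattices and fundamental domains\<close>

definition rational_points :: "nat \<Rightarrow> nvec set" where
  "rational_points n = ({..<n} \<rightarrow>\<^sub>E \<rat>)"

lemma countable_rational_points: "countable (rational_points n)"
  unfolding rational_points_def by (intro countable_PiE countable_rat) auto

lemma rational_points_subset_Rn: "rational_points n \<subseteq> Rn n"
  unfolding rational_points_def Rn_def by (rule PiE_mono) auto

lemma rational_points_dense:
  assumes "e > 0"
  obtains d where "d \<in> rational_points n" "ndist n x d < e"
proof -
  \<comment> \<open>The denominator \<open>n + 1\<close> keeps the sum of the \<open>n\<close>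
    coordinate errors strictly below \<open>e\<close> and also covers \<open>n = 0\<close>.\<close>
  have "\<exists>q\<in>\<rat>. \<bar>x i - q\<bar> < e / (n + 1)" for i
  proof -
    have "x i - e / (n + 1) < x i + e / (n + 1)" using divide_pos_pos[OF assms, of "real (n + 1)"] by simp
    from Rats_dense_in_real[OF this] obtain q where "q \<in> \<rat>" "x i - e / (n + 1) < q" "q < x i + e / (n + 1)"
      by blast
    then show ?thesis by (intro bexI[of _ q]) auto
  qed
  then obtain q where q: "\<And>i. q i \<in> \<rat>" "\<And>i. \<bar>x i - q i\<bar> < e / (n + 1)"
    by metis
  show ?thesis
  proof
    show "restrict q {..<n} \<in> rational_points n"
      using q by (auto simp: rational_points_def)
    have "ndist n x (restrict q {..<n}) = ndist n x q"
      by (rule ndist_cong) auto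
    also have "\<dots> \<le> (\<Sum>i<n. \<bar>x i - q i\<bar>)"
      unfolding ndist_eq by (rule L2_set_le_sum_abs)
    also have "\<dots> \<le> n * (e / (n + 1))"
      using sum_bounded_above[of "{..<n}" "\<lambda>i. \<bar>x i - q i\<bar>" "e / (n + 1)"] q(2)
      by (simp add: less_imp_le)
    also have "\<dots> < e" using assms by (simp add: field_simps)
    finally show "ndist n x (restrict q {..<n}) < e" .
  qed
qed

lemma is_latticeD:
  assumes "is_lattice n \<Lambda>"
  shows is_lattice_subset: "\<Lambda> \<subseteq> Rn n"
    and is_lattice_nonempty: "\<Lambda> \<noteq> {}"
    and is_lattice_countable: "countable \<Lambda>"
    and is_lattice_vplus: "p \<in> \<Lambda> \<Longrightarrow> q \<in> \<Lambda> \<Longrightarrow> vplus n p q \<in> \<Lambda>"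
    and is_lattice_vscale: "p \<in> \<Lambda> \<Longrightarrow> vscale n (- 1) p \<in> \<Lambda>"
proof -
  obtain b where b: "\<Lambda> = lattice_of n b"
    using assms by (auto simp: is_lattice_def)
  define L where "L k = (\<lambda>j\<in>{..<n}. \<Sum>i<n. of_int (k i) * b i j)" for k :: "nat \<Rightarrow> int"
  have L: "\<Lambda> = range L"
    unfolding b lattice_of_def L_def ..
  have L_Rn: "L k \<in> Rn n" for k by (simp add: L_def Rn_def)
  show "\<Lambda> \<subseteq> Rn n" "\<Lambda> \<noteq> {}" using L_Rn by (auto simp: L)
  \<comment> \<open>Only the coefficients with index below \<open>n\<close> enter, so the lattice is
    the image of a countable set of finite integer tuples.\<close>
  have "L k = L (restrict k {..<n})" for k
    by (simp add: L_def)
  then have "\<Lambda> \<subseteq> L ` ({..<n} \<rightarrow>\<^sub>E UNIV)"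
    unfolding L by (metis (no_types, lifting) UNIV_I image_eqI image_subsetI restrict_PiE_iff)
  moreover have "countable (L ` ({..<n} \<rightarrow>\<^sub>E (UNIV :: int set)))"
    by (intro countable_image countable_PiE) auto
  ultimately show "countable \<Lambda>" by (rule countable_subset)
  show "vplus n p q \<in> \<Lambda>" if pq: "p \<in> \<Lambda>" "q \<in> \<Lambda>"
  proof -
    obtain k l where "p = L k" "q = L l" using pq by (auto simp: L)
    moreover have "vplus n (L k) (L l) = L (\<lambda>i. k i + l i)"
      by (rule Rn_eqI[OF vplus_in_Rn L_Rn]) (simp add: L_def algebra_simps sum.distrib)
    ultimately show ?thesis by (simp add: L)
  qed
  show "vscale n (- 1) p \<in> \<Lambda>" if p: "p \<in> \<Lambda>"
  proof -
    obtain k where "p = L k" using p by (auto simp: L)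
    moreover have "vscale n (- 1) (L k) = L (\<lambda>i. - k i)"
      by (rule Rn_eqI[OF vscale_in_Rn L_Rn]) (simp add: L_def sum_negf)
    ultimately show ?thesis by (simp add: L)
  qed
qed

section \<open>The packing lattice, its cosets and a fundamental domain\<close>

locale ball_packing_torus =
  fixes n :: nat and \<Lambda> :: "nvec set"
  assumes packing: "packing_lattice n (nball n 2) \<Lambda>"
begin

lemma lattice: "is_lattice n \<Lambda>"
  using packing by (simp add: packing_lattice_def)

lemmas Rn_lattice [simp, intro] = subsetD[OF is_lattice_subset[OF lattice]]
  and countable_lattice [simp, intro] = is_lattice_countable[OF lattice]
  and vplus_lattice [simp, intro] = is_lattice_vplus[OF lattice]
  and vscale_lattice [simp, intro] = is_lattice_vscale[OF lattice]

lemma zero_lattice [simp, intro]: "vscale n 0 x \<in> \<Lambda>"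
proof -
  obtain p where "p \<in> \<Lambda>" using is_lattice_nonempty[OF lattice] by blast
  moreover from this have "vplus n p (vscale n (- 1) p) \<in> \<Lambda>" by blast
  moreover have "vplus n p (vscale n (- 1) p) = vscale n 0 x"
    by (rule Rn_eqI) auto
  ultimately show ?thesis by simp
qed

text \<open>Otherwise the midpoint of \<open>p\<close> and \<open>q\<close> would lie in both
  translates of the ball of radius 2: with \<open>d = q - p\<close> it is offset by
  \<open>d / 2\<close> from \<open>p\<close> and by \<open>- d / 2\<close> from \<open>q\<close>,
  and both offsets have norm at most 2.\<close>

lemma lattice_separated:
  assumes "p \<in> \<Lambda>" "q \<in> \<Lambda>" "ndist n p q \<le> 4"
  shows "p = q"
proof (rule ccontr)
  assume "p \<noteq> q"
  define d where "d = vplus n q (vscale n (- 1) p)"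
  have d: "nnorm n (vscale n c d) \<le> 2" if "\<bar>c\<bar> = 1 / 2" for c
  proof -
    have "c\<^sup>2 = \<bar>c\<bar>\<^sup>2" by simp
    then have "c\<^sup>2 = 1 / 4" unfolding that by (simp add: power2_eq_square)
    then have "(c * (q i - p i))\<^sup>2 = (1/2 * \<bar>p i - q i\<bar>)\<^sup>2" for i
      by (simp add: power_mult_distrib power2_commute power_divide)
    then have "nnorm n (vscale n c d) = L2_set (\<lambda>i. (1/2) * \<bar>p i - q i\<bar>) {..<n}"
      unfolding nnorm_def L2_set_def
      by (intro arg_cong[where f = sqrt] sum.cong refl) (simp add: d_def)
    also have "\<dots> = (1/2) * L2_set (\<lambda>i. \<bar>p i - q i\<bar>) {..<n}"
      by (rule L2_set_right_distrib[symmetric]) auto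
    also have "L2_set (\<lambda>i. \<bar>p i - q i\<bar>) {..<n} = ndist n p q"
      unfolding ndist_eq L2_set_def by simp
    finally show ?thesis using assms(3) by simp
  qed
  have "vplus n (vscale n (1/2) d) p = vplus n (vscale n (- 1/2) d) q"
    by (rule Rn_eqI) (auto simp: d_def field_simps)
  moreover have "vscale n (1/2) d \<in> nball n 2" "vscale n (- 1/2) d \<in> nball n 2"
    using d by (auto simp: nball_def)
  ultimately have "(\<lambda>x. vplus n x p) ` nball n 2 \<inter> (\<lambda>x. vplus n x q) ` nball n 2 \<noteq> {}"
    by blast
  moreover have "disjoint_family_on (\<lambda>p. (\<lambda>x. vplus n x p) ` nball n 2) \<Lambda>"
    using packing by (simp add: packing_lattice_def)
  ultimately show False
    using assms(1,2) \<open>p \<noteq> q\<close> by (auto simp: disjoint_family_on_def)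
qed

lemma mem_tproj_iff: "y \<in> tproj n \<Lambda> x \<longleftrightarrow> (\<exists>p\<in>\<Lambda>. y = vplus n x p)"
  by (auto simp: tproj_def)

lemma mem_tproj_self: "x \<in> Rn n \<Longrightarrow> x \<in> tproj n \<Lambda> x"
  by (metis mem_tproj_iff vplus_zero zero_lattice)

lemma tproj_vplus: "p \<in> \<Lambda> \<Longrightarrow> tproj n \<Lambda> (vplus n x p) = tproj n \<Lambda> x"
proof (intro equalityI subsetI)
  fix y assume p: "p \<in> \<Lambda>" and "y \<in> tproj n \<Lambda> x"
  then obtain q where q: "q \<in> \<Lambda>" "y = vplus n x q" by (auto simp: mem_tproj_iff)
  have "y = vplus n (vplus n x p) (vplus n (vscale n (- 1) p) q)"
    unfolding q(2) by (rule Rn_eqI) auto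
  then show "y \<in> tproj n \<Lambda> (vplus n x p)" using p q(1) by (auto simp: mem_tproj_iff)
qed (auto simp: mem_tproj_iff vplus_assoc)

lemma tproj_eq: "y \<in> tproj n \<Lambda> x \<Longrightarrow> tproj n \<Lambda> y = tproj n \<Lambda> x"
  by (auto simp: mem_tproj_iff tproj_vplus)

lemma tproj_subset_Rn: "tproj n \<Lambda> x \<subseteq> Rn n"
  by (auto simp: mem_tproj_iff)

lemma torusE:
  assumes "u \<in> torus n \<Lambda>"
  obtains x where "x \<in> Rn n" "u = tproj n \<Lambda> x"
  using assms by (auto simp: torus_def)

lemma torus_mem: "u \<in> torus n \<Lambda> \<Longrightarrow> x \<in> u \<Longrightarrow> tproj n \<Lambda> x = u \<and> x \<in> Rn n"
  using tproj_subset_Rn by (auto simp: torus_def dest: tproj_eq)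

lemma tproj_in_torus [simp]: "x \<in> Rn n \<Longrightarrow> tproj n \<Lambda> x \<in> torus n \<Lambda>"
  by (simp add: torus_def)

lemma mem_Union_torus: "A \<subseteq> torus n \<Lambda> \<Longrightarrow> x \<in> \<Union>A \<longleftrightarrow> x \<in> Rn n \<and> tproj n \<Lambda> x \<in> A"
  using torus_mem mem_tproj_self by blast

lemma Union_tproj_image: "\<Union>(tproj n \<Lambda> ` S) = (\<Union>p\<in>\<Lambda>. (\<lambda>y. vplus n y p) ` S)"
  by (auto simp: tproj_def)

lemma Union_tproj_image_measurable:
  assumes "S \<in> sets (leb n)"
  shows "\<Union>(tproj n \<Lambda> ` S) \<in> sets (leb n)"
  unfolding Union_tproj_image using assms
  by (intro sets.countable_UN' countable_lattice) (auto intro: vplus_image_measurable)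

text \<open>Unit balls around an enumeration of the rational points cover the space. From each ball
  those points are kept whose coset meets no earlier ball, so every coset is represented exactly in
  the first ball that it meets. Two points of one coset in the same unit ball have distance at most
  2 and are equal by \<open>lattice_separated\<close>.\<close>

lemma fundamental_domain_exists: "\<exists>F. is_fundamental_domain n \<Lambda> F"
proof -
  define d where "d = from_nat_into (rational_points n)"
  define sat where "sat i = \<Union>(tproj n \<Lambda> ` nball_at n (d i) 1)" for i :: nat
  define F where "F = (\<Union>i. nball_at n (d i) 1 - (\<Union>j<i. sat j))"
  have sat_iff: "x \<in> sat i \<longleftrightarrow> (\<exists>y\<in>nball_at n (d i) 1. x \<in> tproj n \<Lambda> y)" for x i
    by (auto simp: sat_def)
  have sat_tproj: "y \<in> sat i \<Longrightarrow> x \<in> tproj n \<Lambda> y \<Longrightarrow> x \<in> sat i" for x y i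
    by (metis sat_iff tproj_eq)
  have sets_sat: "sat i \<in> sets (leb n)" for i
    unfolding sat_def by (intro Union_tproj_image_measurable nball_at_measurable)
  have "F \<in> sets (leb n)"
    unfolding F_def using sets_sat by (intro sets.countable_UN sets.Diff sets.finite_UN) auto
  moreover have "\<exists>!y. y \<in> F \<inter> u" if u: "u \<in> torus n \<Lambda>" for u
  proof -
    obtain x where x: "x \<in> Rn n" "u = tproj n \<Lambda> x"
      using torusE[OF u] by metis
    obtain q where q: "q \<in> rational_points n" "ndist n x q < 1"
      by (rule rational_points_dense[of 1]) auto
    moreover obtain i where "d i = q"
      using q(1) from_nat_into_surj[OF countable_rational_points] unfolding d_def by metis
    ultimately have "x \<in> sat i"
      using x(1) mem_tproj_self unfolding sat_iff nball_at_def
      by (auto simp: ndist_commute intro!: bexI[of _ x])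
    define k where "k = (LEAST i. x \<in> sat i)"
    have k: "x \<in> sat k" "\<And>j. j < k \<Longrightarrow> x \<notin> sat j"
      using \<open>x \<in> sat i\<close> unfolding k_def by (auto intro: LeastI dest: not_less_Least)
    obtain y where y: "y \<in> nball_at n (d k) 1" "x \<in> tproj n \<Lambda> y"
      using k(1) sat_iff by auto
    have yu: "y \<in> u" using y x tproj_eq mem_tproj_self nball_at_subset_Rn by (metis subsetD)
    have "y \<in> F"
      using y k(2) sat_tproj unfolding F_def by blast
    moreover have "y = z" if "y \<in> F \<inter> u" "z \<in> F \<inter> u" for y z
    proof -
      obtain i where i: "y \<in> nball_at n (d i) 1" "\<And>i'. i' < i \<Longrightarrow> y \<notin> sat i'"
        using \<open>y \<in> F \<inter> u\<close> unfolding F_def by auto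
      obtain j where j: "z \<in> nball_at n (d j) 1" "\<And>j'. j' < j \<Longrightarrow> z \<notin> sat j'"
        using \<open>z \<in> F \<inter> u\<close> unfolding F_def by auto
      have yz: "y \<in> tproj n \<Lambda> z" "z \<in> tproj n \<Lambda> y"
        using that torus_mem[OF u] mem_tproj_self by blast+
      have "\<not> i < j" "\<not> j < i"
        using i j yz sat_iff by blast+
      then have "i = j" by simp
      obtain p where p: "p \<in> \<Lambda>" "z = vplus n y p" using yz(2) by (auto simp: mem_tproj_iff)
      have yz_Rn: "y \<in> Rn n" "z \<in> Rn n" using i j nball_at_subset_Rn by blast+
      have "ndist n y z \<le> 2"
        using i(1) j(1) \<open>i = j\<close> ndist_triangle[of n y z "d i"] by (auto simp: nball_at_def ndist_commute)
      moreover have "ndist n y z = ndist n (vscale n 0 y) p"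
        unfolding p(2) by (rule ndist_cong) auto
      ultimately have "vscale n 0 y = p"
        using p(1) by (intro lattice_separated) auto
      then show ?thesis using p(2) vplus_zero yz_Rn by metis
    qed
    ultimately show ?thesis using yu by blast
  qed
  ultimately show ?thesis
    unfolding is_fundamental_domain_def by (intro exI[of _ F] conjI ballI)
qed

section \<open>The quotient measure on the torus\<close>

abbreviation FD :: "nvec set" where "FD \<equiv> fundamental_domain n \<Lambda>"

abbreviation TM :: "nvec set measure" where "TM \<equiv> torus_measure n \<Lambda>"

lemma fundamental_domain: "is_fundamental_domain n \<Lambda> FD"
  unfolding fundamental_domain_def using fundamental_domain_exists by (rule someI_ex)

lemma FD_measurable [measurable]: "FD \<in> sets (leb n)"
  using fundamental_domain by (simp add: is_fundamental_domain_def)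

lemma FD_unique: "x \<in> Rn n \<Longrightarrow> \<exists>!y. y \<in> FD \<and> y \<in> tproj n \<Lambda> x"
  using fundamental_domain by (simp add: is_fundamental_domain_def)

lemma space_TM [simp]: "space TM = torus n \<Lambda>"
  unfolding torus_measure_def by (simp add: space_measure_of_conv)

lemma sets_TM: "sets TM = sigma_sets (torus n \<Lambda>) {A. A \<subseteq> torus n \<Lambda> \<and> \<Union>A \<in> sets (leb n)}"
  unfolding torus_measure_def by (subst sets_distr, subst sets_measure_of) auto

lemma sets_TM_I: "A \<subseteq> torus n \<Lambda> \<Longrightarrow> \<Union>A \<in> sets (leb n) \<Longrightarrow> A \<in> sets TM"
  unfolding sets_TM by (rule sigma_sets.Basic) auto

text \<open>Inside \<open>FD\<close>, the preimage of \<open>A\<close> under the projection is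
  \<open>FD \<inter> \<Union>A\<close>. Measurability of the projection is checked on the generators
  of the sigma-algebra of the torus, which is defined through exactly such preimages.\<close>

lemma emeasure_TM:
  assumes "A \<subseteq> torus n \<Lambda>" "\<Union>A \<in> sets (leb n)"
  shows "emeasure TM A = emeasure (leb n) (FD \<inter> \<Union>A)"
proof -
  let ?G = "{A. A \<subseteq> torus n \<Lambda> \<and> \<Union>A \<in> sets (leb n)}"
  let ?R = "restrict_space (leb n) FD"
  have FD_Rn: "FD \<subseteq> Rn n" using sets.sets_into_space[OF FD_measurable] by simp
  have sp: "space ?R = FD" using FD_Rn by (auto simp: space_restrict_space)
  have vim: "tproj n \<Lambda> -` A \<inter> FD = FD \<inter> \<Union>A" if "A \<subseteq> torus n \<Lambda>" for A
    using mem_Union_torus[OF that] FD_Rn by blast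
  have "tproj n \<Lambda> \<in> ?R \<rightarrow>\<^sub>M sigma (torus n \<Lambda>) ?G"
  proof (rule measurable_measure_of)
    show "tproj n \<Lambda> \<in> space ?R \<rightarrow> torus n \<Lambda>"
      using FD_Rn by (auto simp: sp)
    fix A assume "A \<in> ?G"
    then show "tproj n \<Lambda> -` A \<inter> space ?R \<in> sets ?R"
      by (auto simp: sp vim sets_restrict_space)
  qed auto
  moreover have "A \<in> sets (sigma (torus n \<Lambda>) ?G)"
    using assms by (subst sets_measure_of) auto
  ultimately have "emeasure TM A = emeasure ?R (FD \<inter> \<Union>A)"
    unfolding torus_measure_def by (subst emeasure_distr) (auto simp: sp vim assms)
  also have "\<dots> = emeasure (leb n) (FD \<inter> \<Union>A)"
    using FD_Rn by (subst emeasure_restrict_space) (auto simp: Int_absorb2)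
  finally show ?thesis .
qed

lemma tproj_image_measurable: "S \<in> sets (leb n) \<Longrightarrow> tproj n \<Lambda> ` S \<in> sets TM"
  using sets.sets_into_space[of S "leb n"]
  by (intro sets_TM_I Union_tproj_image_measurable) auto

lemma vplus_image_uminus:
  assumes "A \<subseteq> Rn n"
  shows "(\<lambda>y. vplus n y p) ` (\<lambda>y. vplus n y (vscale n (- 1) p)) ` A = A"
proof -
  have "vplus n (vplus n y (vscale n (- 1) p)) p = y" if "y \<in> A" for y
    using assms that by (intro vplus_inverse) auto
  then show ?thesis by (force simp: image_image)
qed

lemma emeasure_Int_vplus_image:
  assumes "A \<in> sets (leb n)" "S \<in> sets (leb n)"
  shows "emeasure (leb n) (A \<inter> (\<lambda>y. vplus n y p) ` S)
    = emeasure (leb n) ((\<lambda>y. vplus n y (vscale n (- 1) p)) ` A \<inter> S)"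
proof -
  have AS: "A \<subseteq> Rn n" "S \<subseteq> Rn n"
    using assms[THEN sets.sets_into_space] by auto
  have inj: "inj_on (\<lambda>y. vplus n y p) (Rn n)"
    by (rule inj_on_inverseI[of _ "\<lambda>y. vplus n y (vscale n (- 1) p)"]) (simp add: vplus_inverse)
  have "(\<lambda>y. vplus n y p) ` ((\<lambda>y. vplus n y (vscale n (- 1) p)) ` A \<inter> S) = A \<inter> (\<lambda>y. vplus n y p) ` S"
    using AS by (subst inj_on_image_Int[OF inj]) (auto simp: vplus_image_uminus)
  moreover have "(\<lambda>y. vplus n y (vscale n (- 1) p)) ` A \<inter> S \<in> sets (leb n)"
    by (intro sets.Int vplus_image_measurable assms)
  ultimately show ?thesis
    using emeasure_vplus_image[of "(\<lambda>y. vplus n y (vscale n (- 1) p)) ` A \<inter> S" n p] by simp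
qed

text \<open>The set \<open>S\<close> is cut and pasted: the pieces of \<open>FD\<close> inside the
  translates \<open>S + p\<close> are moved back by \<open>- p\<close>, where they become
  \<open>S \<inter> (FD - p)\<close>. As the sets \<open>FD - p\<close> partition the space, the
  pieces reassemble \<open>S\<close>. The resulting value does not involve the chosen fundamental
  domain.\<close>

lemma emeasure_tproj_image:
  assumes S: "S \<in> sets (leb n)" and disj: "disjoint_family_on (\<lambda>p. (\<lambda>y. vplus n y p) ` S) \<Lambda>"
  shows "emeasure TM (tproj n \<Lambda> ` S) = emeasure (leb n) S"
proof -
  let ?neg = "\<lambda>p y. vplus n y (vscale n (- 1) p)"
  have S_Rn: "S \<subseteq> Rn n" using sets.sets_into_space[OF S] by simp
  have FD_Rn: "FD \<subseteq> Rn n" using sets.sets_into_space[OF FD_measurable] by simp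
  have "emeasure TM (tproj n \<Lambda> ` S) = emeasure (leb n) (\<Union>p\<in>\<Lambda>. FD \<inter> (\<lambda>y. vplus n y p) ` S)"
    using S S_Rn by (subst emeasure_TM) (auto simp: Union_tproj_image intro: Union_tproj_image_measurable[unfolded Union_tproj_image])
  also have "\<dots> = (\<integral>\<^sup>+p. emeasure (leb n) (FD \<inter> (\<lambda>y. vplus n y p) ` S) \<partial>count_space \<Lambda>)"
    using S disj by (intro emeasure_UN_countable)
      (auto simp: vplus_image_measurable disjoint_family_on_def)
  also have "\<dots> = (\<integral>\<^sup>+p. emeasure (leb n) (?neg p ` FD \<inter> S) \<partial>count_space \<Lambda>)"
    using S by (intro nn_integral_cong emeasure_Int_vplus_image) auto
  also have "\<dots> = emeasure (leb n) (\<Union>p\<in>\<Lambda>. ?neg p ` FD \<inter> S)"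
  proof (rule emeasure_UN_countable[symmetric])
    show "disjoint_family_on (\<lambda>p. ?neg p ` FD \<inter> S) \<Lambda>"
      unfolding disjoint_family_on_def
    proof (intro ballI impI)
      fix p q assume pq: "p \<in> \<Lambda>" "q \<in> \<Lambda>" "p \<noteq> q"
      have False if x: "x \<in> ?neg p ` FD" "x \<in> ?neg q ` FD" for x
      proof -
        obtain y z where y: "y \<in> FD" "x = ?neg p y" and z: "z \<in> FD" "x = ?neg q z"
          using x by auto
        have y': "y = vplus n x p" "z = vplus n x q"
          using subsetD[OF FD_Rn y(1)] subsetD[OF FD_Rn z(1)]
          by (simp_all add: y(2) vplus_inverse) (simp add: y(2)[symmetric] z(2) vplus_inverse)
        have "x \<in> Rn n" using y by simp
        then have "y = z"
          using y(1) z(1) FD_unique[of x] pq y' unfolding mem_tproj_iff by blast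
        then have "vplus n x p = vplus n x q" using y' by simp
        then show False using pq by (simp add: vplus_cancel)
      qed
      then show "(?neg p ` FD \<inter> S) \<inter> (?neg q ` FD \<inter> S) = {}" by blast
    qed
  qed (use S in \<open>auto simp: vplus_image_measurable\<close>)
  also have "(\<Union>p\<in>\<Lambda>. ?neg p ` FD \<inter> S) = S"
  proof (intro equalityI subsetI)
    fix x assume x: "x \<in> S"
    then obtain y p where yp: "y \<in> FD" "p \<in> \<Lambda>" "y = vplus n x p"
      using FD_unique[of x] S_Rn unfolding mem_tproj_iff by blast
    then have "x = ?neg p y" using x S_Rn by (auto simp: vplus_inverse)
    then show "x \<in> (\<Union>p\<in>\<Lambda>. ?neg p ` FD \<inter> S)" using yp x by blast
  qed auto
  finally show ?thesis .
qed

end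

subsection \<open>Balls in the torus\<close>

lemma nu_pos: "0 < nu n"
  and emeasure_nball_at: "0 < r \<Longrightarrow> emeasure (leb n) (nball_at n x r) = ennreal (nu n * r ^ n)"
proof -
  have "nu n = unit_ball_vol n"
    unfolding nu_def nball_eq[of n 1 undefined] measure_def
    by (simp add: emeasure_nball_at_unit_ball_vol)
  then show "0 < nu n" "0 < r \<Longrightarrow> emeasure (leb n) (nball_at n x r) = ennreal (nu n * r ^ n)"
    by (simp_all add: emeasure_nball_at_unit_ball_vol)
qed

text \<open>With \<open>a = x - u\<close> and \<open>v = z - u\<close>, the identity behind this is
  \<open>(a + t v)\<^sup>2 = (1 + t) a\<^sup>2 + t (1 + t) v\<^sup>2 - t (a - v)\<^sup>2\<close>. As in the usual bound for a
  spherical cap, the part of a ball that lies outside a slightly shifted ball is contained in a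
  smaller ball.\<close>
lemma nball_at_diff_subset:
  assumes "0 \<le> t" "0 \<le> q" "0 \<le> r'" "ndist n u z \<le> e"
    and "(1 + t) * r\<^sup>2 + t * (1 + t) * e\<^sup>2 - t * r'\<^sup>2 \<le> q\<^sup>2"
  shows "nball_at n u r - nball_at n z r' \<subseteq> nball_at n (\<lambda>i. u i - t * (z i - u i)) q"
proof
  fix x assume x: "x \<in> nball_at n u r - nball_at n z r'"
  let ?w = "\<lambda>i. u i - t * (z i - u i)"
  have "(ndist n ?w x)\<^sup>2 = (1 + t) * (ndist n u x)\<^sup>2 + t * (1 + t) * (ndist n u z)\<^sup>2 - t * (ndist n z x)\<^sup>2"
    unfolding ndist_power2 sum_distrib_left sum.distrib[symmetric] sum_subtractf[symmetric]
    by (intro sum.cong refl) (simp add: power2_eq_square algebra_simps)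
  also have "\<dots> \<le> (1 + t) * r\<^sup>2 + t * (1 + t) * e\<^sup>2 - t * r'\<^sup>2"
  proof -
    have "(1 + t) * (ndist n u x)\<^sup>2 \<le> (1 + t) * r\<^sup>2"
      using assms(1) x by (intro mult_left_mono power_mono) (auto simp: nball_at_def)
    moreover have "t * (1 + t) * (ndist n u z)\<^sup>2 \<le> t * (1 + t) * e\<^sup>2"
      using assms(1,4) by (intro mult_left_mono power_mono) auto
    moreover have "t * r'\<^sup>2 \<le> t * (ndist n z x)\<^sup>2"
      using assms(1,3) x by (intro mult_left_mono power_mono) (auto simp: nball_at_def)
    ultimately show ?thesis by linarith
  qed
  finally have "(ndist n ?w x)\<^sup>2 \<le> q\<^sup>2" using assms(5) by linarith
  then have "ndist n ?w x \<le> q" using assms(2) by (rule power2_le_imp_le)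
  then show "x \<in> nball_at n ?w q" using x by (simp add: nball_at_def)
qed

context ball_packing_torus
begin

text \<open>The centre is a vector and not a coset, so that balls are handled through
  representatives. For radii below 2 these are the closed balls of \<open>tdist\<close>, by
  \<open>tdist_le_iff\<close>.\<close>

definition tball :: "nvec \<Rightarrow> real \<Rightarrow> nvec set set" where
  "tball x r = tproj n \<Lambda> ` nball_at n x r"

lemma tball_measurable [measurable, simp]: "tball x r \<in> sets TM"
  unfolding tball_def by (intro tproj_image_measurable nball_at_measurable)

lemma tball_subset_torus: "tball x r \<subseteq> torus n \<Lambda>"
  using subsetD[OF nball_at_subset_Rn] by (auto simp: tball_def)

text \<open>If two lattice translates of a ball of radius \<open>r \<le> 2\<close> met, their
  lattice vectors would be at distance at most \<open>2 * r \<le> 4\<close>, hence equal. Such balls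
  therefore embed into the torus and keep their Euclidean volume.\<close>

lemma emeasure_tball:
  assumes "0 < r" "r \<le> 2"
  shows "emeasure TM (tball x r) = ennreal (nu n * r ^ n)"
proof -
  have "disjoint_family_on (\<lambda>p. (\<lambda>y. vplus n y p) ` nball_at n x r) \<Lambda>"
    unfolding disjoint_family_on_def
  proof (intro ballI impI)
    fix p q assume pq: "p \<in> \<Lambda>" "q \<in> \<Lambda>" "p \<noteq> q"
    have False if "y \<in> nball_at n (vplus n x p) r" "y \<in> nball_at n (vplus n x q) r" for y
    proof -
      have "ndist n p q = ndist n (vplus n x p) (vplus n x q)" by (simp add: ndist_vplus_same)
      also have "\<dots> \<le> 4"
        using that assms(2) ndist_triangle[of n "vplus n x p" "vplus n x q" y]
        by (auto simp: nball_at_def ndist_commute)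
      finally show False using lattice_separated pq by blast
    qed
    then show "(\<lambda>y. vplus n y p) ` nball_at n x r \<inter> (\<lambda>y. vplus n y q) ` nball_at n x r = {}"
      using pq by (auto simp: vplus_image_nball_at)
  qed
  then show ?thesis
    unfolding tball_def using assms
    by (simp add: emeasure_tproj_image emeasure_nball_at)
qed

lemma measure_tball:
  assumes "0 < r" "r \<le> 2"
  shows "measure TM (tball x r) = nu n * r ^ n"
  using assms nu_pos[of n] by (simp add: measure_def emeasure_tball less_imp_le)

text \<open>The torus contains an embedded unit ball. This makes the volume of the torus positive,
  and its ratio to \<open>nu n\<close> at least 1 in the tail bound for the total count.\<close>

lemma nu_le_emeasure_torus: "ennreal (nu n) \<le> emeasure TM (torus n \<Lambda>)"
proof -
  have "torus n \<Lambda> \<in> sets TM" using sets.top[of TM] by simp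
  then show ?thesis
    using emeasure_mono[OF tball_subset_torus, of TM undefined 1] by (simp add: emeasure_tball)
qed

lemma tproj_mem_tball_iff:
  assumes "y \<in> Rn n"
  shows "tproj n \<Lambda> y \<in> tball x r \<longleftrightarrow> (\<exists>p\<in>\<Lambda>. ndist n x (vplus n y p) \<le> r)"
proof
  assume "tproj n \<Lambda> y \<in> tball x r"
  then obtain z where z: "z \<in> nball_at n x r" "tproj n \<Lambda> y = tproj n \<Lambda> z"
    by (auto simp: tball_def)
  then have "z \<in> tproj n \<Lambda> y"
    using mem_tproj_self nball_at_subset_Rn by blast
  then show "\<exists>p\<in>\<Lambda>. ndist n x (vplus n y p) \<le> r"
    using z(1) by (auto simp: mem_tproj_iff nball_at_def)
next
  assume "\<exists>p\<in>\<Lambda>. ndist n x (vplus n y p) \<le> r"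
  then obtain p where "p \<in> \<Lambda>" "vplus n y p \<in> nball_at n x r"
    by (auto simp: nball_at_def)
  then show "tproj n \<Lambda> y \<in> tball x r"
    unfolding tball_def by (metis image_eqI tproj_vplus)
qed

lemma tproj_self_mem_tball: "x \<in> Rn n \<Longrightarrow> 0 \<le> r \<Longrightarrow> tproj n \<Lambda> x \<in> tball x r"
  unfolding tball_def by (rule imageI) (simp add: nball_at_def)

lemma tball_vplus: "p \<in> \<Lambda> \<Longrightarrow> tball (vplus n x p) r = tball x r"
  unfolding tball_def by (simp add: vplus_image_nball_at[symmetric] image_image tproj_vplus)

lemma tball_mono: "ndist n x y + r \<le> r' \<Longrightarrow> tball y r \<subseteq> tball x r'"
proof -
  assume *: "ndist n x y + r \<le> r'"
  have "nball_at n y r \<subseteq> nball_at n x r'"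
  proof
    fix w assume "w \<in> nball_at n y r"
    then show "w \<in> nball_at n x r'"
      using * ndist_triangle[of n x w y] by (simp add: nball_at_def)
  qed
  then show ?thesis unfolding tball_def by (rule image_mono)
qed

lemma tball_sym:
  assumes "x \<in> Rn n" "y \<in> Rn n"
  shows "tproj n \<Lambda> y \<in> tball x r \<longleftrightarrow> tproj n \<Lambda> x \<in> tball y r"
proof -
  have "tproj n \<Lambda> x \<in> tball y r" if xy: "x \<in> Rn n" "y \<in> Rn n" "tproj n \<Lambda> y \<in> tball x r" for x y
  proof -
    obtain p where p: "p \<in> \<Lambda>" "ndist n x (vplus n y p) \<le> r"
      using xy(3) unfolding tproj_mem_tball_iff[OF xy(2)] by blast
    have "tproj n \<Lambda> x \<in> tball (vplus n y p) r"
      using p xy(1) unfolding tball_def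
      by (intro imageI) (simp add: nball_at_def ndist_commute)
    then show ?thesis by (simp add: tball_vplus p)
  qed
  then show ?thesis using assms by blast
qed

lemma tball_trans:
  assumes "y \<in> Rn n" "tproj n \<Lambda> y \<in> tball x r" "v \<in> tball y r'"
  shows "v \<in> tball x (r + r')"
proof -
  obtain p where p: "p \<in> \<Lambda>" "ndist n x (vplus n y p) \<le> r"
    using assms(2) tproj_mem_tball_iff[OF assms(1)] by auto
  have "tball (vplus n y p) r' \<subseteq> tball x (r + r')"
    using p by (intro tball_mono) simp
  then show ?thesis using assms(3) p by (auto simp: tball_vplus)
qed

text \<open>After replacing \<open>z\<close> by its lattice translate within \<open>e\<close> of
  \<open>u\<close>, the Euclidean inclusion \<open>nball_at_diff_subset\<close> is projected; a
  difference of images is contained in the image of the difference.\<close>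

lemma tball_diff_subset:
  assumes "0 \<le> t" "0 \<le> q" "0 \<le> r'" "z \<in> Rn n" "tproj n \<Lambda> z \<in> tball u e"
    and "(1 + t) * r\<^sup>2 + t * (1 + t) * e\<^sup>2 - t * r'\<^sup>2 \<le> q\<^sup>2"
  obtains w where "tball u r - tball z r' \<subseteq> tball w q"
proof -
  obtain p where p: "p \<in> \<Lambda>" "ndist n u (vplus n z p) \<le> e"
    using assms(5) tproj_mem_tball_iff[OF assms(4)] by auto
  let ?z = "vplus n z p"
  have "tball u r - tball ?z r' \<subseteq> tproj n \<Lambda> ` (nball_at n u r - nball_at n ?z r')"
    unfolding tball_def by blast
  also have "\<dots> \<subseteq> tball (\<lambda>i. u i - t * (?z i - u i)) q"
    unfolding tball_def using nball_at_diff_subset[OF assms(1-3) p(2) assms(6)] by (rule image_mono)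
  finally show ?thesis using that p by (simp add: tball_vplus)
qed

section \<open>Distance, covering, density and multiplicity in terms of balls in the torus\<close>

lemma tdist_eq: "tdist n (tproj n \<Lambda> x) (tproj n \<Lambda> y)
    = (INF p\<in>\<Lambda>. ndist n x (vplus n y p))"
proof -
  have "(\<lambda>(a, b). ndist n a b) ` (tproj n \<Lambda> x \<times> tproj n \<Lambda> y) = (\<lambda>p. ndist n x (vplus n y p)) ` \<Lambda>"
  proof (intro equalityI subsetI)
    fix d assume "d \<in> (\<lambda>(a, b). ndist n a b) ` (tproj n \<Lambda> x \<times> tproj n \<Lambda> y)"
    then obtain p q where pq: "p \<in> \<Lambda>" "q \<in> \<Lambda>" "d = ndist n (vplus n x p) (vplus n y q)"
      by (auto simp: mem_tproj_iff)
    then have "d = ndist n x (vplus n y (vplus n q (vscale n (- 1) p)))"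
      by (simp add: ndist_vplus_uminus vplus_assoc)
    then show "d \<in> (\<lambda>p. ndist n x (vplus n y p)) ` \<Lambda>" using pq by blast
  next
    fix d assume "d \<in> (\<lambda>p. ndist n x (vplus n y p)) ` \<Lambda>"
    then obtain p where p: "p \<in> \<Lambda>" "d = ndist n x (vplus n y p)" by blast
    then have "d = ndist n (vplus n x (vscale n 0 x)) (vplus n y p)"
      by (auto intro: ndist_cong)
    moreover have "(vplus n x (vscale n 0 x), vplus n y p) \<in> tproj n \<Lambda> x \<times> tproj n \<Lambda> y"
      using p by (auto simp: mem_tproj_iff)
    ultimately show "d \<in> (\<lambda>(a, b). ndist n a b) ` (tproj n \<Lambda> x \<times> tproj n \<Lambda> y)"
      by (intro image_eqI) auto
  qed
  then show ?thesis unfolding tdist_def by simp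
qed

lemma bdd_below_ndist: "bdd_below ((\<lambda>p. ndist n x (f p)) ` A)"
  by (rule bdd_belowI[of _ 0]) auto

text \<open>By the packing property at most one translate of \<open>y\<close> has distance less than \<open>2\<close> from \<open>x\<close>, so
  that the infimum in the definition of the distance is attained.\<close>
lemma tdist_le_iff:
  assumes "y \<in> Rn n" "r < 2"
  shows "tdist n (tproj n \<Lambda> x) (tproj n \<Lambda> y) \<le> r \<longleftrightarrow> tproj n \<Lambda> y \<in> tball x r"
proof
  assume le: "tdist n (tproj n \<Lambda> x) (tproj n \<Lambda> y) \<le> r"
  have ne: "\<Lambda> \<noteq> {}" using zero_lattice by blast
  have ex: "\<exists>p\<in>\<Lambda>. ndist n x (vplus n y p) < r'" if "r < r'" for r'
    using le that cINF_less_iff[OF ne bdd_below_ndist, of x "vplus n y" r']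
    unfolding tdist_eq by auto
  obtain p where p: "p \<in> \<Lambda>" "ndist n x (vplus n y p) < 2"
    using ex assms(2) by blast
  \<comment> \<open>A lattice vector achieving a distance below some \<open>r' < 2\<close> must be
    \<open>p\<close> itself, so the distance achieved by \<open>p\<close> is at most every
    \<open>r'\<close> between \<open>r\<close> and 2.\<close>
  have "ndist n x (vplus n y p) \<le> r"
  proof (rule dense_ge_bounded[OF assms(2)])
    fix r' assume r': "r < r'" "r' < 2"
    obtain q where q: "q \<in> \<Lambda>" "ndist n x (vplus n y q) < r'"
      using ex r'(1) by blast
    have "ndist n p q = ndist n (vplus n y p) (vplus n y q)" by (simp add: ndist_vplus_same)
    also have "\<dots> \<le> 4"
      using p q r'(2) ndist_triangle[of n "vplus n y p" "vplus n y q" x] by (simp add: ndist_commute)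
    finally have "p = q" using p q lattice_separated by blast
    then show "ndist n x (vplus n y p) \<le> r'" using q by simp
  qed
  then show "tproj n \<Lambda> y \<in> tball x r"
    using p(1) tproj_mem_tball_iff[OF assms(1)] by blast
next
  assume "tproj n \<Lambda> y \<in> tball x r"
  then obtain p where "p \<in> \<Lambda>" "ndist n x (vplus n y p) \<le> r"
    using tproj_mem_tball_iff[OF assms(1)] by auto
  then show "tdist n (tproj n \<Lambda> x) (tproj n \<Lambda> y) \<le> r"
    unfolding tdist_eq by (intro cINF_lower2[OF bdd_below_ndist])
qed

lemma tsum_nball_subset: "tsum n \<Lambda> A (nball n 1) \<subseteq> torus n \<Lambda>"
  by (auto simp: tsum_def)

text \<open>The unit ball is symmetric, so a point is covered by a ball around an element of
  \<open>A\<close> iff the ball around that point contains an element of \<open>A\<close>. Covering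
  thereby becomes a condition on counts.\<close>

lemma mem_tsum_nball_iff:
  assumes "y \<in> Rn n" "A \<subseteq> torus n \<Lambda>"
  shows "tproj n \<Lambda> y \<in> tsum n \<Lambda> A (nball n 1) \<longleftrightarrow> A \<inter> tball y 1 \<noteq> {}"
proof
  assume "tproj n \<Lambda> y \<in> tsum n \<Lambda> A (nball n 1)"
  then obtain x b where xb: "x \<in> \<Union>A" "b \<in> nball n 1" "tproj n \<Lambda> y = tproj n \<Lambda> (vplus n x b)"
    by (auto simp: tsum_def)
  have x: "x \<in> Rn n" "tproj n \<Lambda> x \<in> A"
    using xb(1) mem_Union_torus[OF assms(2)] by blast+
  have "ndist n (vplus n x b) x = ndist n (vscale n 0 x) b"
    by (rule ndist_cong) auto
  also have "\<dots> \<le> 1"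
    using xb(2) nball_eq[of n 1 x] by (simp add: nball_at_def)
  finally have "tproj n \<Lambda> (vplus n x b) \<in> tball x 1"
    unfolding tball_def by (intro imageI) (simp add: nball_at_def ndist_commute)
  then have "tproj n \<Lambda> x \<in> tball y 1"
    using tball_sym[OF x(1) assms(1)] xb(3) by simp
  then show "A \<inter> tball y 1 \<noteq> {}" using x by blast
next
  assume "A \<inter> tball y 1 \<noteq> {}"
  then obtain x where x: "tproj n \<Lambda> x \<in> A" "x \<in> nball_at n y 1"
    by (auto simp: tball_def)
  define b where "b = vplus n y (vscale n (- 1) x)"
  have x_Rn: "x \<in> Rn n" using x nball_at_subset_Rn by blast
  have "ndist n (vscale n 0 x) b = ndist n y x"
    by (rule ndist_cong) (auto simp: b_def)
  then have "b \<in> nball n 1"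
    using x(2) nball_eq[of n 1 x] by (simp add: nball_at_def) (simp add: b_def)
  moreover have "x \<in> \<Union>A" using x(1) x_Rn mem_tproj_self by blast
  moreover have "vplus n x b = y"
    using assms(1) by (intro Rn_eqI) (auto simp: b_def)
  ultimately show "tproj n \<Lambda> y \<in> tsum n \<Lambda> A (nball n 1)"
    unfolding tsum_def by blast
qed

lemma tsum_singleton:
  assumes "x \<in> Rn n"
  shows "tsum n \<Lambda> {tproj n \<Lambda> x} (nball n 1) = tball x 1"
proof -
  have "tproj n \<Lambda> y \<in> tsum n \<Lambda> {tproj n \<Lambda> x} (nball n 1) \<longleftrightarrow> tproj n \<Lambda> y \<in> tball x 1"
    if "y \<in> Rn n" for y
    using mem_tsum_nball_iff[OF that, of "{tproj n \<Lambda> x}"] tball_sym[OF assms that] assms by auto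
  then have "u \<in> tsum n \<Lambda> {tproj n \<Lambda> x} (nball n 1) \<longleftrightarrow> u \<in> tball x 1" if "u \<in> torus n \<Lambda>" for u
    using that by (metis torusE)
  then show ?thesis
    using tsum_nball_subset tball_subset_torus by blast
qed

lemma torus_subset_tsum_iff:
  assumes "A \<subseteq> torus n \<Lambda>"
  shows "torus n \<Lambda> \<subseteq> tsum n \<Lambda> A (nball n 1) \<longleftrightarrow> (\<forall>y\<in>Rn n. A \<inter> tball y 1 \<noteq> {})"
  using mem_tsum_nball_iff[OF _ assms] by (auto simp: torus_def)

text \<open>All unit balls in the torus have volume \<open>nu n\<close>, so the integrand is
  constant. Working in \<open>ennreal\<close> includes the case of infinite
  \<open>A\<close>.\<close>

lemma cover_density_eq:
  assumes "A \<subseteq> torus n \<Lambda>"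
  shows "cover_density n \<Lambda> A = ennreal (nu n) / emeasure TM (torus n \<Lambda>) * ecount A"
proof -
  have "cover_density n \<Lambda> A
      = (\<integral>\<^sup>+ x. ennreal (nu n) / emeasure TM (torus n \<Lambda>) \<partial>count_space A)"
    unfolding cover_density_def
  proof (rule nn_integral_cong)
    fix u assume "u \<in> space (count_space A)"
    then obtain x where "x \<in> Rn n" "u = tproj n \<Lambda> x" using assms by (auto elim: torusE)
    then show "emeasure TM (tsum n \<Lambda> {u} (nball n 1)) / emeasure TM (torus n \<Lambda>)
        = ennreal (nu n) / emeasure TM (torus n \<Lambda>)"
      by (simp add: tsum_singleton emeasure_tball)
  qed
  also have "\<dots> = ennreal (nu n) / emeasure TM (torus n \<Lambda>) * emeasure (count_space A) A"
    by simp
  also have "emeasure (count_space A) A = ecount A"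
    unfolding ecount_def by (cases "finite A") simp_all
  finally show ?thesis .
qed

lemma max_mult_le_iff:
  assumes "A \<subseteq> torus n \<Lambda>"
  shows "max_mult n \<Lambda> A \<le> c \<longleftrightarrow> (\<forall>y\<in>Rn n. ecount (A \<inter> tball y 1) \<le> c)"
proof -
  have "{x \<in> A. tdist n (tproj n \<Lambda> y) x \<le> 1} = A \<inter> tball y 1" if "y \<in> Rn n" for y
  proof -
    have "tdist n (tproj n \<Lambda> y) x \<le> 1 \<longleftrightarrow> x \<in> tball y 1" if x: "x \<in> A" for x
    proof -
      obtain x' where "x' \<in> Rn n" "x = tproj n \<Lambda> x'" using x assms by (meson subsetD torusE)
      then show ?thesis using tdist_le_iff[of x' 1 y] by simp
    qed
    then show ?thesis by blast
  qed
  then show ?thesis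
    by (simp add: max_mult_def SUP_le_iff torus_def)
qed

text \<open>A maximal \<open>s\<close>-separated set is a net of scale \<open>s\<close>, since any
  point violating this could be added. The balls of radius \<open>s / 2\<close> around it are
  disjoint; comparing volumes bounds its size, and the same bound guarantees that a maximal set
  exists. The condition \<open>s \<le> 4\<close> keeps these radii in the range of
  \<open>emeasure_tball\<close>.\<close>

lemma torus_net:
  assumes V: "emeasure TM (torus n \<Lambda>) \<le> ennreal V" "0 \<le> V" and s: "0 < s" "s \<le> 4"
  obtains Z where "finite Z" "Z \<subseteq> Rn n" "real (card Z) * (nu n * (s / 2) ^ n) \<le> V"
    "\<And>y. y \<in> Rn n \<Longrightarrow> \<exists>z\<in>Z. tproj n \<Lambda> z \<in> tball y s"
proof -
  define c where "c = nu n * (s / 2) ^ n"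
  have c: "c > 0" using nu_pos s by (simp add: c_def)
  define sep where "sep Z \<longleftrightarrow> finite Z \<and> Z \<subseteq> Rn n \<and>
    (\<forall>z\<in>Z. \<forall>z'\<in>Z. z \<noteq> z' \<longrightarrow> tproj n \<Lambda> z' \<notin> tball z s)" for Z
  have card_le: "real (card Z) * c \<le> V" if "sep Z" for Z
  proof -
    have Z: "finite Z" "Z \<subseteq> Rn n" using that by (auto simp: sep_def)
    have "disjoint_family_on (\<lambda>z. tball z (s/2)) Z"
      unfolding disjoint_family_on_def
    proof (intro ballI impI)
      fix z z' assume z: "z \<in> Z" "z' \<in> Z" "z \<noteq> z'"
      have False if v: "v \<in> tball z (s/2)" "v \<in> tball z' (s/2)" for v
      proof -
        obtain w where w: "w \<in> Rn n" "v = tproj n \<Lambda> w"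
          using v tball_subset_torus by (meson subsetD torusE)
        have z_Rn: "z \<in> Rn n" "z' \<in> Rn n" using z Z by auto
        have "tproj n \<Lambda> z' \<in> tball w (s/2)"
          using v w tball_sym[OF z_Rn(2) w(1)] by simp
        then have "tproj n \<Lambda> z' \<in> tball z (s/2 + s/2)"
          using v w by (intro tball_trans[OF w(1)]) auto
        then show False using \<open>sep Z\<close> z by (simp add: sep_def)
      qed
      then show "tball z (s/2) \<inter> tball z' (s/2) = {}" by blast
    qed
    then have "emeasure TM (\<Union>z\<in>Z. tball z (s/2)) = (\<Sum>z\<in>Z. emeasure TM (tball z (s/2)))"
      using Z by (intro sum_emeasure[symmetric]) auto
    also have "\<dots> = of_nat (card Z) * ennreal c"
      using s by (simp add: emeasure_tball c_def)
    also have "\<dots> = ennreal (real (card Z) * c)"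
      using c by (simp add: ennreal_mult ennreal_of_nat_eq_real_of_nat)
    finally have "ennreal (real (card Z) * c) = emeasure TM (\<Union>z\<in>Z. tball z (s/2))" ..
    also have "\<dots> \<le> emeasure TM (torus n \<Lambda>)"
      using tball_subset_torus sets.top[of TM] by (intro emeasure_mono) auto
    also have "\<dots> \<le> ennreal V" by fact
    finally show ?thesis using V(2) by (simp add: ennreal_le_iff)
  qed
  have bd: "card Z \<le> nat \<lceil>V / c\<rceil>" if "sep Z" for Z
  proof -
    have "real (card Z) \<le> V / c"
      using card_le[OF that] c by (simp add: pos_le_divide_eq)
    then show ?thesis by linarith
  qed
  have "sep {}" by (simp add: sep_def)
  \<comment> \<open>The greatest-element principle asks for a strict bound on the cardinalities,
    hence the successor.\<close>
  then have "\<exists>Z. sep Z \<and> (\<forall>Z'. sep Z' \<longrightarrow> card Z' \<le> card Z)"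
    using bd by (intro less_Suc_eq_le[THEN iffD2] ex_has_greatest_nat[of sep "{}" card "Suc (nat \<lceil>V / c\<rceil>)"] allI impI)
  then obtain Z where Z: "sep Z" "\<And>Z'. sep Z' \<Longrightarrow> card Z' \<le> card Z"
    by auto
  have "\<exists>z\<in>Z. tproj n \<Lambda> z \<in> tball y s" if y: "y \<in> Rn n" for y
  proof (rule ccontr)
    assume *: "\<not> ?thesis"
    then have "y \<notin> Z" using tproj_self_mem_tball[OF y] s by force
    have "sep (insert y Z)"
      unfolding sep_def
    proof (intro conjI ballI impI)
      have Z_Rn: "z \<in> Rn n" if "z \<in> Z" for z using that Z(1) by (auto simp: sep_def)
      fix z z' assume "z \<in> insert y Z" "z' \<in> insert y Z" "z \<noteq> z'"
      then consider "z \<in> Z" "z' \<in> Z" "z \<noteq> z'" | "z = y" "z' \<in> Z" | "z \<in> Z" "z' = y" by auto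
      then show "tproj n \<Lambda> z' \<notin> tball z s"
      proof cases
        case 1
        then show ?thesis using Z(1) by (simp add: sep_def)
      next
        case 2
        then show ?thesis using * by blast
      next
        case 3
        then show ?thesis using * tball_sym[OF Z_Rn[OF 3(1)] y] by blast
      qed
    qed (use Z(1) y in \<open>auto simp: sep_def\<close>)
    then have "card (insert y Z) \<le> card Z" by (rule Z(2))
    then show False using \<open>y \<notin> Z\<close> Z(1) by (simp add: sep_def)
  qed
  then show ?thesis
    using that[of Z] Z(1) card_le[OF Z(1)] by (simp add: sep_def c_def)
qed

end

subsection \<open>Tail bounds and measurability\<close>

text \<open>The sequence lies in a box. With the singleton of \<open>undefined\<close> as factor for
  every index from \<open>n\<close> on, the box is a product of compact sets over all indices, so it
  is compact and, by metrizability, sequentially compact. Convergence of the first \<open>n\<close>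
  coordinates gives convergence in \<open>ndist\<close>.\<close>

lemma Rn_convergent_subseq:
  assumes f: "\<And>m. f m \<in> Rn n" "\<And>m. ndist n x (f m) \<le> R"
  obtains u \<phi> where "u \<in> Rn n" "strict_mono (\<phi> :: nat \<Rightarrow> nat)" "(\<lambda>m. ndist n u (f (\<phi> m))) \<longlonglongrightarrow> 0"
proof -
  define S where "S i = (if i < n then {x i - R..x i + R} else {undefined})" for i
  have "compact (PiE UNIV S)"
    unfolding compactin_euclidean_iff[symmetric] euclidean_product_topology[symmetric] compactin_PiE
    by (auto simp: S_def compactin_euclidean_iff)
  then have "seq_compact (PiE UNIV S)"
    by (simp only: compact_eq_seq_compact_metric)
  moreover have "f m \<in> PiE UNIV S" for m
  proof -
    have "f m i \<in> S i" for i
    proof (cases "i < n")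
      case True
      have "\<bar>x i - f m i\<bar> \<le> ndist n x (f m)"
        using member_le_L2_set[of "{..<n}" i "\<lambda>i. \<bar>x i - f m i\<bar>"] True
        by (simp add: ndist_eq L2_set_def)
      then show ?thesis using f(2)[of m] True by (auto simp: S_def abs_le_iff)
    next
      case False
      then show ?thesis using Rn_undefined[OF f(1)] by (simp add: S_def)
    qed
    then show ?thesis by auto
  qed
  ultimately obtain u \<phi> where u: "u \<in> PiE UNIV S" "strict_mono (\<phi> :: nat \<Rightarrow> nat)" "(f \<circ> \<phi>) \<longlonglongrightarrow> u"
    unfolding seq_compact_def by metis
  have coord: "(\<lambda>m. f (\<phi> m) i) \<longlonglongrightarrow> u i" for i
  proof -
    have "isCont (\<lambda>y::nvec. y i) u"
      using continuous_on_product_coordinates[of i] continuous_on_eq_continuous_at[OF open_UNIV] by blast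
    from isCont_tendsto_compose[OF this u(3)] show ?thesis by simp
  qed
  have "(\<lambda>m. sqrt (\<Sum>i<n. (u i - f (\<phi> m) i)\<^sup>2)) \<longlonglongrightarrow> sqrt (\<Sum>i<n. (u i - u i)\<^sup>2)"
    by (intro tendsto_intros coord)
  then have "(\<lambda>m. ndist n u (f (\<phi> m))) \<longlonglongrightarrow> 0"
    by (simp add: ndist_eq L2_set_def)
  moreover have "u \<in> Rn n"
  proof -
    have "u i = undefined" if "\<not> i < n" for i
      using u(1) that by (auto simp: S_def PiE_iff split: if_splits dest: spec[of _ i])
    then show ?thesis by (simp add: Rn_def PiE_iff extensional_def)
  qed
  ultimately show ?thesis using that u(2) by blast
qed

lemma ecount_mono: "A \<subseteq> B \<Longrightarrow> ecount A \<le> ecount B"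
  unfolding ecount_def by (rule emeasure_mono) auto

lemma ecount_empty [simp]: "ecount {} = 0"
  by (simp add: ecount_def)

lemma ecount_eq_0_iff: "ecount A = 0 \<longleftrightarrow> A = {}"
  by (cases "finite A") (auto simp: ecount_def)

lemma ecount_infinite: "infinite A \<Longrightarrow> ecount A = \<infinity>"
  by (simp add: ecount_def)

section \<open>Chernoff bounds for Poisson counts\<close>

lemma poisson_process_sets:
  assumes "poisson_process P N \<rho> X" "S \<in> sets N"
  shows "(\<lambda>\<omega>. ecount (X \<omega> \<inter> S)) \<in> borel_measurable P"
  using assms by (simp add: poisson_process_def)

text \<open>This is Markov's inequality for \<open>\<theta> ^ N\<close> with \<open>N\<close> the
  count in \<open>S\<close>; values of \<open>\<theta>\<close> above and below 1 give the two tails.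
  The events \<open>A k\<close> collect the finite counts outside \<open>J\<close>. Bounding the
  complement of their union also takes care of outcomes with infinite count, which lie in
  it.\<close>

lemma poisson_process_chernoff:
  assumes pp: "poisson_process P N \<rho> X" and S: "S \<in> sets N" and \<theta>: "0 < \<theta>"
    and J: "\<And>k. k \<in> J \<Longrightarrow> exp c \<le> \<theta> ^ k"
    and m: "m = \<rho> * measure N S" "0 \<le> m"
    and B: "B \<in> sets P" "\<And>\<omega> k. \<omega> \<in> B \<Longrightarrow> ecount (X \<omega> \<inter> S) = of_nat k \<Longrightarrow> k \<in> J"
  shows "measure P B \<le> exp (m * (\<theta> - 1) - c)"
proof -
  interpret prob_space P using pp by (simp add: poisson_process_def)
  have meas: "(\<lambda>\<omega>. ecount (X \<omega> \<inter> S)) \<in> borel_measurable P"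
    using pp S by (rule poisson_process_sets)
  define A where "A k = (if k \<in> J then {} else {\<omega> \<in> space P. ecount (X \<omega> \<inter> S) = of_nat k})" for k
  have A_sets: "A k \<in> events" for k
    using meas unfolding A_def by (auto intro!: measurable_equality_set)
  have pmf: "prob {\<omega> \<in> space P. ecount (X \<omega> \<inter> S) = of_nat k} = m ^ k / fact k * exp (- m)" for k
    using pp S by (simp add: poisson_process_def m(1))
  have "disjoint_family A"
    by (auto simp: disjoint_family_on_def A_def)
  then have A_sums: "(\<lambda>k. prob (A k)) sums prob (\<Union>k. A k)"
    using A_sets by (intro finite_measure_UNION) auto
  have "(\<lambda>k. x ^ k / fact k) sums exp x" for x :: real
    using exp_converges[of x] by (simp add: scaleR_conv_of_real field_simps)
  then have e: "(\<lambda>k. x ^ k / fact k * y) sums (exp x * y)" for x y :: real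
    by (rule sums_mult2)
  \<comment> \<open>The series are compared termwise: for \<open>k\<close> in \<open>J\<close> the
    Poisson weight is at most its multiple by \<open>\<theta> ^ k * exp (- c)\<close>, and for other
    \<open>k\<close> the left term vanishes.\<close>
  have "1 - prob (\<Union>k. A k) \<le> exp (m * \<theta>) * exp (- m - c)"
  proof (rule sums_le)
    show "(\<lambda>k. m ^ k / fact k * exp (- m) - prob (A k)) sums (1 - prob (\<Union>k. A k))"
      using sums_diff[OF e[of m "exp (- m)"] A_sums] by (simp add: exp_minus)
    show "(\<lambda>k. (m * \<theta>) ^ k / fact k * exp (- m - c)) sums (exp (m * \<theta>) * exp (- m - c))"
      by (rule e)
    fix k
    show "m ^ k / fact k * exp (- m) - prob (A k) \<le> (m * \<theta>) ^ k / fact k * exp (- m - c)"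
    proof (cases "k \<in> J")
      case True
      then have "1 \<le> \<theta> ^ k * exp (- c)"
        using J[OF True] by (simp add: exp_minus field_simps)
      then have "m ^ k / fact k * exp (- m) * 1 \<le> m ^ k / fact k * exp (- m) * (\<theta> ^ k * exp (- c))"
        using m(2) by (intro mult_left_mono) auto
      then show ?thesis using True by (simp add: A_def power_mult_distrib exp_diff exp_minus field_simps)
    next
      case False
      then show ?thesis using m \<theta> by (simp add: A_def pmf)
    qed
  qed
  also have "exp (m * \<theta>) * exp (- m - c) = exp (m * (\<theta> - 1) - c)"
    by (simp add: mult_exp_exp algebra_simps)
  finally have *: "1 - prob (\<Union>k. A k) \<le> exp (m * (\<theta> - 1) - c)" .
  have "B \<subseteq> space P - (\<Union>k. A k)"
    using B(2) sets.sets_into_space[OF B(1)] by (auto simp: A_def split: if_splits)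
  then have "prob B \<le> prob (space P - (\<Union>k. A k))"
    using A_sets by (intro finite_measure_mono) auto
  also have "\<dots> = 1 - prob (\<Union>k. A k)"
    using A_sets by (intro prob_compl) auto
  finally show ?thesis using * by linarith
qed

lemma of_nat_le_ennreal_iff: "0 \<le> K \<Longrightarrow> (of_nat k \<le> ennreal K) \<longleftrightarrow> real k \<le> K"
  by (simp add: ennreal_of_nat_eq_real_of_nat ennreal_le_iff)

text \<open>For \<open>\<theta> \<ge> 1\<close> the exponent is nondecreasing in the mean, so an
  upper bound \<open>m\<close> for the mean is enough.\<close>

lemma poisson_process_upper_tail:
  assumes pp: "poisson_process P N \<rho> X" and S: "S \<in> sets N" and \<theta>: "1 \<le> \<theta>"
    and m: "\<rho> * measure N S \<le> m" "0 \<le> \<rho>" and K: "0 \<le> K"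
  shows "measure P {\<omega> \<in> space P. \<not> ecount (X \<omega> \<inter> S) \<le> ennreal K} \<le> exp (m * (\<theta> - 1) - K * ln \<theta>)"
proof -
  have "measure P {\<omega> \<in> space P. \<not> ecount (X \<omega> \<inter> S) \<le> ennreal K}
      \<le> exp (\<rho> * measure N S * (\<theta> - 1) - K * ln \<theta>)"
  proof (rule poisson_process_chernoff[OF pp S, where J = "{k. K < real k}"])
    show "{\<omega> \<in> space P. \<not> ecount (X \<omega> \<inter> S) \<le> ennreal K} \<in> sets P"
      using poisson_process_sets[OF pp S] by measurable
    fix k assume "k \<in> {k. K < real k}"
    then have "K * ln \<theta> \<le> real k * ln \<theta>" using \<theta> by (intro mult_right_mono) auto
    then have "exp (K * ln \<theta>) \<le> exp (ln \<theta>) ^ k" by (simp add: exp_of_nat_mult[symmetric])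
    then show "exp (K * ln \<theta>) \<le> \<theta> ^ k" using \<theta> by simp
  qed (use \<theta> m K of_nat_le_ennreal_iff[OF K] in auto)
  also have "\<dots> \<le> exp (m * (\<theta> - 1) - K * ln \<theta>)"
    using m \<theta> by (simp add: mult_right_mono)
  finally show ?thesis .
qed

text \<open>For \<open>\<theta> \<le> 1\<close> both signs turn: \<open>ln \<theta>\<close> is not
  positive, and the exponent is nonincreasing in the mean, so \<open>m\<close> is a lower bound
  here.\<close>

lemma poisson_process_lower_tail:
  assumes pp: "poisson_process P N \<rho> X" and S: "S \<in> sets N" and \<theta>: "0 < \<theta>" "\<theta> \<le> 1"
    and m: "m \<le> \<rho> * measure N S" "0 \<le> \<rho>" and K: "0 \<le> K"
  shows "measure P {\<omega> \<in> space P. ecount (X \<omega> \<inter> S) \<le> ennreal K} \<le> exp (m * (\<theta> - 1) - K * ln \<theta>)"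
proof -
  have "measure P {\<omega> \<in> space P. ecount (X \<omega> \<inter> S) \<le> ennreal K}
      \<le> exp (\<rho> * measure N S * (\<theta> - 1) - K * ln \<theta>)"
  proof (rule poisson_process_chernoff[OF pp S, where J = "{k. real k \<le> K}"])
    show "{\<omega> \<in> space P. ecount (X \<omega> \<inter> S) \<le> ennreal K} \<in> sets P"
      using poisson_process_sets[OF pp S] by measurable
    fix k assume "k \<in> {k. real k \<le> K}"
    then have "K * ln \<theta> \<le> real k * ln \<theta>" using \<theta> by (intro mult_right_mono_neg) auto
    then have "exp (K * ln \<theta>) \<le> exp (ln \<theta>) ^ k" by (simp add: exp_of_nat_mult[symmetric])
    then show "exp (K * ln \<theta>) \<le> \<theta> ^ k" using \<theta> by simp
  qed (use \<theta> m K of_nat_le_ennreal_iff[OF K] in auto)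
  also have "\<dots> \<le> exp (m * (\<theta> - 1) - K * ln \<theta>)"
    using m \<theta> by (simp add: mult_right_mono_neg)
  finally show ?thesis .
qed

section \<open>Measurability of the good event\<close>

context ball_packing_torus
begin

text \<open>The radii decrease to 1 and \<open>a\<close> has distance greater than 1 from the
  centre. The summand 2 in the denominator keeps the radii below 2, where
  \<open>tdist_le_iff\<close> applies.\<close>

lemma eventually_not_in_tball:
  assumes "a \<in> torus n \<Lambda>" "a \<notin> tball y 1"
  shows "eventually (\<lambda>m. a \<notin> tball y (1 + 1 / (real m + 2))) sequentially"
proof -
  obtain x where x: "x \<in> Rn n" "a = tproj n \<Lambda> x" using assms(1) by (rule torusE)
  have "1 < tdist n (tproj n \<Lambda> y) a"
    using assms(2) tdist_le_iff[OF x(1), of 1 y] x(2) by simp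
  moreover have "(\<lambda>m. 1 + 1 / (real m + 2)) \<longlonglongrightarrow> 1 + 0"
    by real_asymp
  ultimately have "eventually (\<lambda>m. 1 + 1 / (real m + 2) < tdist n (tproj n \<Lambda> y) a) sequentially"
    by (intro order_tendstoD(2)) auto
  then show ?thesis
  proof eventually_elim
    case (elim m)
    have "1 / (real m + 2) < 1" by simp
    then show ?case
      using elim tdist_le_iff[OF x(1), of "1 + 1 / (real m + 2)" y] x(2) by simp
  qed
qed

lemma finite_tball_gap:
  assumes "finite A" "A \<subseteq> torus n \<Lambda>"
  obtains m :: nat where "A \<inter> tball y (1 + 1 / (real m + 2)) \<subseteq> tball y 1"
proof -
  have "eventually (\<lambda>m. \<forall>a\<in>A. a \<notin> tball y 1 \<longrightarrow> a \<notin> tball y (1 + 1 / (real m + 2))) sequentially"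
    using assms(1)
  proof (rule eventually_ball_finite, intro ballI)
    fix a assume "a \<in> A"
    then show "eventually (\<lambda>m. a \<notin> tball y 1 \<longrightarrow> a \<notin> tball y (1 + 1 / (real m + 2))) sequentially"
      using eventually_not_in_tball[of a y] assms(2) by (cases "a \<in> tball y 1") auto
  qed
  then obtain m where "\<forall>a\<in>A. a \<notin> tball y 1 \<longrightarrow> a \<notin> tball y (1 + 1 / (real m + 2))"
    using eventually_happens'[OF sequentially_bot] by blast
  then show ?thesis using that by blast
qed

text \<open>A rational centre \<open>d\<close> close to \<open>y\<close> has an element of
  \<open>A\<close> within distance 1, which is then hardly farther than 1 from \<open>y\<close>.
  Finiteness of \<open>A\<close> provides a gap above radius 1 that forces this element into
  \<open>tball y 1\<close>.\<close>

lemma covered_iff_rational: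
  assumes "finite A" "A \<subseteq> torus n \<Lambda>"
  shows "(\<forall>y\<in>Rn n. A \<inter> tball y 1 \<noteq> {}) \<longleftrightarrow> (\<forall>d\<in>rational_points n. A \<inter> tball d 1 \<noteq> {})"
proof (intro iffI ballI)
  fix y assume *: "\<forall>d\<in>rational_points n. A \<inter> tball d 1 \<noteq> {}" and y: "y \<in> Rn n"
  obtain m where m: "A \<inter> tball y (1 + 1 / (real m + 2)) \<subseteq> tball y 1"
    using finite_tball_gap[OF assms] by blast
  obtain d where d: "d \<in> rational_points n" "ndist n y d < 1 / (real m + 2)"
    by (rule rational_points_dense[of "1 / (real m + 2)" n y]) auto
  have "tball d 1 \<subseteq> tball y (1 + 1 / (real m + 2))"
    using d by (intro tball_mono) auto
  then show "A \<inter> tball y 1 \<noteq> {}" using m * d(1) by blast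
qed (use rational_points_subset_Rn in auto)

text \<open>Unit balls with rational centres could miss a point of high multiplicity, so slightly
  enlarged balls are used. If every enlargement had a bad centre, these centres, moved into a
  bounded region by lattice vectors, would accumulate at some \<open>u\<close>; since
  \<open>A\<close> is finite, an enlarged ball around a centre close to \<open>u\<close> contains no
  element of \<open>A\<close> outside \<open>tball u 1\<close>, a contradiction.\<close>

lemma multiplicity_le_iff_rational:
  assumes "finite A" "A \<subseteq> torus n \<Lambda>"
  shows "(\<forall>y\<in>Rn n. ecount (A \<inter> tball y 1) \<le> c) \<longleftrightarrow>
    (\<exists>m::nat. \<forall>d\<in>rational_points n. ecount (A \<inter> tball d (1 + 1 / (real m + 2))) \<le> c)"
proof
  assume "\<exists>m::nat. \<forall>d\<in>rational_points n. ecount (A \<inter> tball d (1 + 1 / (real m + 2))) \<le> c"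
  then obtain m :: nat where m: "\<And>d. d \<in> rational_points n \<Longrightarrow> ecount (A \<inter> tball d (1 + 1 / (real m + 2))) \<le> c"
    by blast
  show "\<forall>y\<in>Rn n. ecount (A \<inter> tball y 1) \<le> c"
  proof
    fix y
    obtain d where d: "d \<in> rational_points n" "ndist n y d < 1 / (real m + 2)"
      by (rule rational_points_dense[of "1 / (real m + 2)" n y]) auto
    have "tball y 1 \<subseteq> tball d (1 + 1 / (real m + 2))"
      using d by (intro tball_mono) (simp add: ndist_commute)
    then have "ecount (A \<inter> tball y 1) \<le> ecount (A \<inter> tball d (1 + 1 / (real m + 2)))"
      by (intro ecount_mono) auto
    also have "\<dots> \<le> c" using m d by blast
    finally show "ecount (A \<inter> tball y 1) \<le> c" .
  qed
next
  assume le: "\<forall>y\<in>Rn n. ecount (A \<inter> tball y 1) \<le> c"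
  show "\<exists>m::nat. \<forall>d\<in>rational_points n. ecount (A \<inter> tball d (1 + 1 / (real m + 2))) \<le> c"
  proof (rule ccontr)
    assume "\<not> ?thesis"
    then have "\<exists>d. d \<in> Rn n \<and> \<not> ecount (A \<inter> tball d (1 + 1 / (real m + 2))) \<le> c" for m :: nat
      using rational_points_subset_Rn by blast
    then obtain d where d: "\<And>m. d m \<in> Rn n" "\<And>m::nat. \<not> ecount (A \<inter> tball (d m) (1 + 1 / (real m + 2))) \<le> c"
      by metis
    define rep where "rep a = (SOME x. x \<in> Rn n \<and> a = tproj n \<Lambda> x)" for a
    have rep: "rep a \<in> Rn n \<and> a = tproj n \<Lambda> (rep a)" if "a \<in> A" for a
    proof -
      have "\<exists>x. x \<in> Rn n \<and> a = tproj n \<Lambda> x" using that assms(2) by (meson subsetD torusE)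
      then show ?thesis unfolding rep_def by (rule someI_ex)
    qed
    define o0 where "o0 = vscale n 0 undefined"
    define R where "R = (\<Sum>a\<in>A. ndist n o0 (rep a)) + 2"
    \<comment> \<open>A bad ball contains an element of \<open>A\<close>, because the empty count 0
      is at most \<open>c\<close>. Its radius is at most 2, which is the summand 2 in
      \<open>R\<close>.\<close>
    have "\<exists>p\<in>\<Lambda>. ndist n o0 (vplus n (d m) p) \<le> R" for m
    proof -
      have "A \<inter> tball (d m) (1 + 1 / (real m + 2)) \<noteq> {}"
        using d(2)[of m] by auto
      then obtain a where a: "a \<in> A" "a \<in> tball (d m) (1 + 1 / (real m + 2))" by blast
      then have "tproj n \<Lambda> (d m) \<in> tball (rep a) (1 + 1 / (real m + 2))"
        using rep[OF a(1)] d(1) by (metis tball_sym)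
      then obtain p where p: "p \<in> \<Lambda>" "ndist n (rep a) (vplus n (d m) p) \<le> 1 + 1 / (real m + 2)"
        using tproj_mem_tball_iff[OF d(1)] by blast
      have "1 / (real m + 2) \<le> 1" by simp
      moreover have "ndist n o0 (rep a) \<le> (\<Sum>a\<in>A. ndist n o0 (rep a))"
        using assms(1) a(1) by (intro member_le_sum) auto
      ultimately have "ndist n o0 (vplus n (d m) p) \<le> R"
        using ndist_triangle[of n o0 "vplus n (d m) p" "rep a"] p(2) unfolding R_def by linarith
      then show ?thesis using p(1) by blast
    qed
    then obtain p where p: "\<And>m. p m \<in> \<Lambda>" "\<And>m. ndist n o0 (vplus n (d m) (p m)) \<le> R" by metis
    obtain u \<phi> where u: "u \<in> Rn n" "strict_mono (\<phi> :: nat \<Rightarrow> nat)"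
        "(\<lambda>m. ndist n u (vplus n (d (\<phi> m)) (p (\<phi> m)))) \<longlonglongrightarrow> 0"
      by (rule Rn_convergent_subseq[of "\<lambda>m. vplus n (d m) (p m)" n o0 R]) (use p in auto)
    obtain m where m: "A \<inter> tball u (1 + 1 / (real m + 2)) \<subseteq> tball u 1"
      using finite_tball_gap[OF assms] by blast
    have "(\<lambda>k. 1 / (real k + 2)) \<longlonglongrightarrow> 0" by real_asymp
    then have "(\<lambda>k. 1 / (real (\<phi> k) + 2)) \<longlonglongrightarrow> 0"
      using LIMSEQ_subseq_LIMSEQ[OF _ u(2)] by (force simp: o_def)
    from tendsto_add[OF u(3) this]
    have "eventually (\<lambda>k. ndist n u (vplus n (d (\<phi> k)) (p (\<phi> k))) + 1 / (real (\<phi> k) + 2) < 1 / (real m + 2)) sequentially"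
      by (intro order_tendstoD(2)) auto
    then obtain k where k: "ndist n u (vplus n (d (\<phi> k)) (p (\<phi> k))) + 1 / (real (\<phi> k) + 2) < 1 / (real m + 2)"
      using eventually_happens'[OF sequentially_bot] by blast
    have "tball (d (\<phi> k)) (1 + 1 / (real (\<phi> k) + 2))
        = tball (vplus n (d (\<phi> k)) (p (\<phi> k))) (1 + 1 / (real (\<phi> k) + 2))"
      using p by (simp add: tball_vplus)
    also have "\<dots> \<subseteq> tball u (1 + 1 / (real m + 2))"
      using k by (intro tball_mono) simp
    finally have "ecount (A \<inter> tball (d (\<phi> k)) (1 + 1 / (real (\<phi> k) + 2))) \<le> ecount (A \<inter> tball u 1)"
      using m by (intro ecount_mono) blast
    also have "\<dots> \<le> c" using le u(1) by blast
    finally show False using d(2) by blast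
  qed
qed

lemma cover_density_finite:
  assumes "A \<subseteq> torus n \<Lambda>" "emeasure TM (torus n \<Lambda>) \<noteq> \<infinity>" "cover_density n \<Lambda> A \<le> ennreal c"
  shows "finite A"
proof (rule ccontr)
  assume "infinite A"
  moreover have "ennreal (nu n) / emeasure TM (torus n \<Lambda>) \<noteq> 0"
    using nu_pos[of n] assms(2) by (simp add: ennreal_divide_eq_0_iff)
  ultimately have "cover_density n \<Lambda> A = \<infinity>"
    unfolding cover_density_eq[OF assms(1)] by (simp add: ecount_infinite ennreal_mult_top)
  then show False using assms(3) by (simp add: top_unique)
qed

text \<open>The event is rewritten by countably many conditions on counts. The rational versions of
  covering and multiplicity are equivalent to the original ones for finite sets; the density
  condition in the same conjunction supplies this finiteness, so the equivalences are shown under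
  it.\<close>

lemma good_event_measurable:
  assumes pp: "poisson_process P TM \<rho> X" and fin: "emeasure TM (torus n \<Lambda>) \<noteq> \<infinity>"
  shows "{\<omega> \<in> space P. torus n \<Lambda> \<subseteq> tsum n \<Lambda> (X \<omega>) (nball n 1) \<and>
      cover_density n \<Lambda> (X \<omega>) \<le> ennreal a \<and> max_mult n \<Lambda> (X \<omega>) \<le> c} \<in> sets P"
    (is "?E \<in> _")
proof -
  let ?D = "rational_points n"
  let ?N = "\<lambda>S \<omega>. ecount (X \<omega> \<inter> S)"
  have N: "?N S \<in> borel_measurable P" if "S \<in> sets TM" for S
    using pp that by (rule poisson_process_sets)
  have X: "X \<omega> \<subseteq> torus n \<Lambda>" if "\<omega> \<in> space P" for \<omega>
    using pp that by (auto simp: poisson_process_def)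
  have T: "torus n \<Lambda> \<in> sets TM" using sets.top[of TM] by simp
  have "{\<omega> \<in> space P. ennreal (nu n) / emeasure TM (torus n \<Lambda>) * ?N (torus n \<Lambda>) \<omega> \<le> ennreal a} \<in> sets P"
    using N[OF T] by measurable
  moreover have "{\<omega> \<in> space P. \<forall>d\<in>?D. ?N (tball d 1) \<omega> \<noteq> 0} \<in> sets P"
  proof (intro sets.sets_Collect_countable_All' countable_rational_points)
    fix d show "{\<omega> \<in> space P. ?N (tball d 1) \<omega> \<noteq> 0} \<in> sets P"
      using N[OF tball_measurable] by measurable
  qed
  moreover have "{\<omega> \<in> space P. \<exists>m::nat. \<forall>d\<in>?D. ?N (tball d (1 + 1 / (real m + 2))) \<omega> \<le> c} \<in> sets P"
  proof (intro sets.sets_Collect_countable_Ex sets.sets_Collect_countable_All' countable_rational_points)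
    fix d and m :: nat show "{\<omega> \<in> space P. ?N (tball d (1 + 1 / (real m + 2))) \<omega> \<le> c} \<in> sets P"
      using N[OF tball_measurable] by measurable
  qed
  ultimately have "{\<omega> \<in> space P. ennreal (nu n) / emeasure TM (torus n \<Lambda>) * ?N (torus n \<Lambda>) \<omega> \<le> ennreal a \<and>
      (\<forall>d\<in>?D. ?N (tball d 1) \<omega> \<noteq> 0) \<and>
      (\<exists>m::nat. \<forall>d\<in>?D. ?N (tball d (1 + 1 / (real m + 2))) \<omega> \<le> c)} \<in> sets P"
    by (intro sets.sets_Collect_conj)
  also have "{\<omega> \<in> space P. ennreal (nu n) / emeasure TM (torus n \<Lambda>) * ?N (torus n \<Lambda>) \<omega> \<le> ennreal a \<and>
      (\<forall>d\<in>?D. ?N (tball d 1) \<omega> \<noteq> 0) \<and>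
      (\<exists>m::nat. \<forall>d\<in>?D. ?N (tball d (1 + 1 / (real m + 2))) \<omega> \<le> c)} = ?E"
  proof (rule Collect_cong, rule conj_cong, rule refl)
    fix \<omega> assume \<omega>: "\<omega> \<in> space P"
    let ?c = "cover_density n \<Lambda> (X \<omega>) \<le> ennreal a"
    have c: "ennreal (nu n) / emeasure TM (torus n \<Lambda>) * ?N (torus n \<Lambda>) \<omega> = cover_density n \<Lambda> (X \<omega>)"
      using X[OF \<omega>] by (simp add: cover_density_eq Int_absorb2)
    have "(\<forall>d\<in>?D. ?N (tball d 1) \<omega> \<noteq> 0) \<longleftrightarrow> torus n \<Lambda> \<subseteq> tsum n \<Lambda> (X \<omega>) (nball n 1)"
      "(\<exists>m::nat. \<forall>d\<in>?D. ?N (tball d (1 + 1 / (real m + 2))) \<omega> \<le> c) \<longleftrightarrow> max_mult n \<Lambda> (X \<omega>) \<le> c"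
      if ?c
    proof -
      have "finite (X \<omega>)" using cover_density_finite[OF X[OF \<omega>] fin that] .
      then show "(\<forall>d\<in>?D. ?N (tball d 1) \<omega> \<noteq> 0) \<longleftrightarrow> torus n \<Lambda> \<subseteq> tsum n \<Lambda> (X \<omega>) (nball n 1)"
        "(\<exists>m::nat. \<forall>d\<in>?D. ?N (tball d (1 + 1 / (real m + 2))) \<omega> \<le> c) \<longleftrightarrow> max_mult n \<Lambda> (X \<omega>) \<le> c"
        using X[OF \<omega>] by (simp_all add: covered_iff_rational multiplicity_le_iff_rational
          torus_subset_tsum_iff max_mult_le_iff ecount_eq_0_iff)
    qed
    then show "(ennreal (nu n) / emeasure TM (torus n \<Lambda>) * ?N (torus n \<Lambda>) \<omega> \<le> ennreal a \<and>
      (\<forall>d\<in>?D. ?N (tball d 1) \<omega> \<noteq> 0) \<and>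
      (\<exists>m::nat. \<forall>d\<in>?D. ?N (tball d (1 + 1 / (real m + 2))) \<omega> \<le> c)) \<longleftrightarrow>
      torus n \<Lambda> \<subseteq> tsum n \<Lambda> (X \<omega>) (nball n 1) \<and>
      cover_density n \<Lambda> (X \<omega>) \<le> ennreal a \<and> max_mult n \<Lambda> (X \<omega>) \<le> c"
      unfolding c by blast
  qed
  finally show ?thesis .
qed

end

subsection \<open>The union bound\<close>

context ball_packing_torus
begin

text \<open>If \<open>tball z r'\<close> contained no element of \<open>A\<close>, all the elements
  in \<open>tball u r\<close> would lie in the difference, against \<open>many\<close> and
  \<open>few\<close>. An element within \<open>r'\<close> of \<open>z\<close> is within
  \<open>s + r' \<le> 1\<close> of \<open>y\<close>.\<close>

lemma covering_criterion:
  assumes "U \<subseteq> Rn n" "\<And>y. y \<in> Rn n \<Longrightarrow> \<exists>u\<in>U. tproj n \<Lambda> u \<in> tball y e"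
    and "Z \<subseteq> Rn n" "\<And>y. y \<in> Rn n \<Longrightarrow> \<exists>z\<in>Z. tproj n \<Lambda> z \<in> tball y s"
    and "s + r' \<le> 1"
    and many: "\<And>u. u \<in> U \<Longrightarrow> \<not> ecount (A \<inter> tball u r) \<le> k"
    and few: "\<And>u z. u \<in> U \<Longrightarrow> z \<in> Z \<Longrightarrow> tproj n \<Lambda> z \<in> tball u e \<Longrightarrow>
      ecount (A \<inter> (tball u r - tball z r')) \<le> k"
    and y: "y \<in> Rn n"
  shows "A \<inter> tball y 1 \<noteq> {}"
proof -
  obtain z where z: "z \<in> Z" "tproj n \<Lambda> z \<in> tball y s" using assms(4) y by blast
  have z_Rn: "z \<in> Rn n" using z(1) assms(3) by blast
  obtain u where u: "u \<in> U" "tproj n \<Lambda> u \<in> tball z e" using assms(2) z_Rn by blast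
  have "tproj n \<Lambda> z \<in> tball u e"
    using u tball_sym[OF z_Rn, of u e] assms(1) by blast
  then have "ecount (A \<inter> (tball u r - tball z r')) \<le> k" using few u z by blast
  moreover have "A \<inter> tball u r \<subseteq> A \<inter> (tball u r - tball z r')" if "A \<inter> tball z r' = {}"
    using that by blast
  ultimately have "A \<inter> tball z r' \<noteq> {}"
    using many[OF u(1)] ecount_mono order_trans by metis
  then obtain v where v: "v \<in> A" "v \<in> tball z r'" by blast
  have "v \<in> tball y (s + r')" using z_Rn z(2) v(2) by (rule tball_trans)
  also have "tball y (s + r') \<subseteq> tball y 1" using assms(5) by (intro tball_mono) simp
  finally show ?thesis using v(1) by blast
qed

lemma multiplicity_criterion:
  assumes "Z \<subseteq> Rn n" "\<And>y. y \<in> Rn n \<Longrightarrow> \<exists>z\<in>Z. tproj n \<Lambda> z \<in> tball y s"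
    and few: "\<And>z. z \<in> Z \<Longrightarrow> ecount (A \<inter> tball z (1 + s)) \<le> k"
    and y: "y \<in> Rn n"
  shows "ecount (A \<inter> tball y 1) \<le> k"
proof -
  obtain z where z: "z \<in> Z" "tproj n \<Lambda> z \<in> tball y s" using assms(2) y by blast
  have "z \<in> Rn n" using z(1) assms(1) by blast
  then have "tproj n \<Lambda> y \<in> tball z s" using z(2) tball_sym y by blast
  then have "tball y 1 \<subseteq> tball z (1 + s)"
    using tball_trans[OF y] by (metis add.commute subsetI)
  then have "ecount (A \<inter> tball y 1) \<le> ecount (A \<inter> tball z (1 + s))" by (intro ecount_mono) blast
  also have "\<dots> \<le> k" using few z by blast
  finally show ?thesis .
qed

definition good_event :: "'w measure \<Rightarrow> ('w \<Rightarrow> nvec set set) \<Rightarrow> real \<Rightarrow> real \<Rightarrow> 'w set" where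
  "good_event P X b c = {\<omega> \<in> space P. torus n \<Lambda> \<subseteq> tsum n \<Lambda> (X \<omega>) (nball n 1) \<and>
      cover_density n \<Lambda> (X \<omega>) \<le> ennreal b \<and> max_mult n \<Lambda> (X \<omega>) \<le> ennreal c}"

text \<open>The four bad events are: too many points in total (\<open>p1\<close>), too few points in
  a ball around the coarse net \<open>U\<close> (\<open>p2\<close>), too many points in the
  difference of balls for a close pair (\<open>p3\<close>), and too many points in an enlarged ball
  around the fine net \<open>Z\<close> (\<open>p4\<close>). The threshold for the total count is the
  one that corresponds to density \<open>b\<close>.\<close>

lemma good_event_union_bound:
  fixes p1 p2 p3 p4 :: real
  assumes pp: "poisson_process P TM \<rho> X" and fin: "emeasure TM (torus n \<Lambda>) \<noteq> \<infinity>"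
    and U: "finite U" "U \<subseteq> Rn n" "\<And>y. y \<in> Rn n \<Longrightarrow> \<exists>u\<in>U. tproj n \<Lambda> u \<in> tball y e"
    and Z: "finite Z" "Z \<subseteq> Rn n" "\<And>y. y \<in> Rn n \<Longrightarrow> \<exists>z\<in>Z. tproj n \<Lambda> z \<in> tball y s"
    and s: "s + r' \<le> 1" and b: "0 \<le> b"
    and p1: "measure P {\<omega> \<in> space P. \<not> ecount (X \<omega> \<inter> torus n \<Lambda>)
        \<le> ennreal (b * (measure TM (torus n \<Lambda>) / nu n))} \<le> p1"
    and p2: "\<And>u. u \<in> U \<Longrightarrow> measure P {\<omega> \<in> space P. ecount (X \<omega> \<inter> tball u r) \<le> ennreal k} \<le> p2"
    and p3: "\<And>u z. u \<in> U \<Longrightarrow> z \<in> Z \<Longrightarrow> tproj n \<Lambda> z \<in> tball u e \<Longrightarrow>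
      measure P {\<omega> \<in> space P. \<not> ecount (X \<omega> \<inter> (tball u r - tball z r')) \<le> ennreal k} \<le> p3"
    and p4: "\<And>z. z \<in> Z \<Longrightarrow> measure P {\<omega> \<in> space P. \<not> ecount (X \<omega> \<inter> tball z (1 + s)) \<le> ennreal c} \<le> p4"
    and p3_nonneg: "0 \<le> p3"
  shows "1 - (p1 + card U * p2 + card U * card Z * p3 + card Z * p4) \<le> measure P (good_event P X b c)"
proof -
  interpret prob_space P using pp by (simp add: poisson_process_def)
  have X: "X \<omega> \<subseteq> torus n \<Lambda>" if "\<omega> \<in> space P" for \<omega>
    using pp that by (auto simp: poisson_process_def)
  have T: "torus n \<Lambda> \<in> sets TM" using sets.top[of TM] by simp
  note N [measurable] = poisson_process_sets[OF pp]
  define B1 where "B1 = {\<omega> \<in> space P. \<not> ecount (X \<omega> \<inter> torus n \<Lambda>)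
        \<le> ennreal (b * (measure TM (torus n \<Lambda>) / nu n))}"
  define B2 where "B2 u = {\<omega> \<in> space P. ecount (X \<omega> \<inter> tball u r) \<le> ennreal k}" for u
  define B3 where "B3 = (\<lambda>(u, z). {\<omega> \<in> space P. \<not> ecount (X \<omega> \<inter> (tball u r - tball z r')) \<le> ennreal k})"
  define B4 where "B4 z = {\<omega> \<in> space P. \<not> ecount (X \<omega> \<inter> tball z (1 + s)) \<le> ennreal c}" for z
  \<comment> \<open>The hypothesis \<open>p3\<close> concerns close pairs, so the union runs over
    these; their number is then bounded by that of all pairs.\<close>
  define W where "W = {(u, z) \<in> U \<times> Z. tproj n \<Lambda> z \<in> tball u e}"
  have W: "finite W" "card W \<le> card U * card Z"
  proof -
    have "W \<subseteq> U \<times> Z" by (auto simp: W_def)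
    then show "finite W" "card W \<le> card U * card Z"
      using U(1) Z(1) finite_subset card_mono[of "U \<times> Z" W] by (auto simp: card_cartesian_product)
  qed
  have sets: "B1 \<in> events" "B2 u \<in> events" "B3 w \<in> events" "B4 z \<in> events" for u w z
  proof -
    show "B1 \<in> events" unfolding B1_def using N[OF T] by measurable
    show "B2 u \<in> events" unfolding B2_def using N[OF tball_measurable] by measurable
    show "B4 z \<in> events" unfolding B4_def using N[OF tball_measurable] by measurable
    have "tball u r - tball z r' \<in> sets TM" for u z by simp
    then show "B3 w \<in> events" unfolding B3_def using N by (cases w) simp
  qed
  define B where "B = B1 \<union> ((\<Union>u\<in>U. B2 u) \<union> ((\<Union>w\<in>W. B3 w) \<union> (\<Union>z\<in>Z. B4 z)))"
  have sub: "space P - B \<subseteq> good_event P X b c"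
  proof
    fix \<omega> assume "\<omega> \<in> space P - B"
    then have \<omega>: "\<omega> \<in> space P" "\<omega> \<notin> B1" "\<And>u. u \<in> U \<Longrightarrow> \<omega> \<notin> B2 u" "\<And>w. w \<in> W \<Longrightarrow> \<omega> \<notin> B3 w"
      "\<And>z. z \<in> Z \<Longrightarrow> \<omega> \<notin> B4 z" by (auto simp: B_def)
    have "X \<omega> \<inter> tball y 1 \<noteq> {}" if "y \<in> Rn n" for y
    proof (rule covering_criterion[OF U(2,3) Z(2,3) s _ _ that, where k = "ennreal k"])
      show "\<not> ecount (X \<omega> \<inter> tball u r) \<le> ennreal k" if "u \<in> U" for u
        using \<omega>(1,3) that by (simp add: B2_def)
      show "ecount (X \<omega> \<inter> (tball u r - tball z r')) \<le> ennreal k"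
        if "u \<in> U" "z \<in> Z" "tproj n \<Lambda> z \<in> tball u e" for u z
        using \<omega>(1) \<omega>(4)[of "(u, z)"] that by (simp add: B3_def W_def)
    qed
    then have "torus n \<Lambda> \<subseteq> tsum n \<Lambda> (X \<omega>) (nball n 1)"
      using torus_subset_tsum_iff[OF X] \<omega>(1) by blast
    moreover have "max_mult n \<Lambda> (X \<omega>) \<le> ennreal c"
      unfolding max_mult_le_iff[OF X[OF \<omega>(1)]]
    proof
      fix y assume "y \<in> Rn n"
      then show "ecount (X \<omega> \<inter> tball y 1) \<le> ennreal c"
        using Z(2,3) \<omega>(1,5) by (intro multiplicity_criterion[of Z s]) (auto simp: B4_def)
    qed
    moreover have "cover_density n \<Lambda> (X \<omega>) \<le> ennreal b"
    proof -
      define v where "v = measure TM (torus n \<Lambda>)"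
      have v: "emeasure TM (torus n \<Lambda>) = ennreal v"
        unfolding v_def using fin by (rule emeasure_eq_ennreal_measure[unfolded infinity_ennreal_def[symmetric]])
      have "v > 0"
        using nu_le_emeasure_torus nu_pos[of n] unfolding v
        by (metis ennreal_le_iff2 less_le_trans not_less)
      have "cover_density n \<Lambda> (X \<omega>) = ennreal (nu n) / ennreal v * ecount (X \<omega> \<inter> torus n \<Lambda>)"
        using cover_density_eq[OF X[OF \<omega>(1)]] X[OF \<omega>(1)] by (simp add: v Int_absorb2)
      also have "\<dots> \<le> ennreal (nu n) / ennreal v * ennreal (b * (v / nu n))"
        using \<omega>(1,2) by (intro mult_left_mono) (auto simp: B1_def v_def)
      also have "\<dots> = ennreal (nu n / v * (b * (v / nu n)))"
        using \<open>v > 0\<close> nu_pos[of n] b by (simp add: divide_ennreal ennreal_mult[symmetric])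
      also have "nu n / v * (b * (v / nu n)) = b"
        using \<open>v > 0\<close> nu_pos[of n] by simp
      finally show ?thesis .
    qed
    ultimately show "\<omega> \<in> good_event P X b c" using \<omega>(1) by (simp add: good_event_def)
  qed
  have "prob B \<le> prob B1 + (prob (\<Union>u\<in>U. B2 u) + (prob (\<Union>w\<in>W. B3 w) + prob (\<Union>z\<in>Z. B4 z)))"
  proof -
    have e: "(\<Union>u\<in>U. B2 u) \<in> events" "(\<Union>w\<in>W. B3 w) \<in> events" "(\<Union>z\<in>Z. B4 z) \<in> events"
      using sets U(1) W(1) Z(1) by auto
    show ?thesis
      unfolding B_def
      by (intro order_trans[OF measure_Un_le] add_left_mono) (use sets e in auto)
  qed
  also have "\<dots> \<le> p1 + (card U * p2 + (card U * card Z * p3 + card Z * p4))"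
  proof (intro add_mono)
    show "prob B1 \<le> p1" using p1 by (simp add: B1_def)
    have "prob (\<Union>u\<in>U. B2 u) \<le> (\<Sum>u\<in>U. prob (B2 u))"
      using U sets by (intro finite_measure_subadditive_finite) auto
    also have "\<dots> \<le> card U * p2"
      using p2 by (intro sum_bounded_above) (simp add: B2_def)
    finally show "prob (\<Union>u\<in>U. B2 u) \<le> card U * p2" .
    have "prob (\<Union>w\<in>W. B3 w) \<le> (\<Sum>w\<in>W. prob (B3 w))"
      using W sets by (intro finite_measure_subadditive_finite) auto
    also have "\<dots> \<le> card W * p3"
      using p3 by (intro sum_bounded_above) (auto simp: B3_def W_def)
    also have "\<dots> \<le> real (card U * card Z) * p3"
      using W(2) p3_nonneg by (intro mult_right_mono) (simp_all only: of_nat_le_iff)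
    finally show "prob (\<Union>w\<in>W. B3 w) \<le> card U * card Z * p3" by simp
    have "prob (\<Union>z\<in>Z. B4 z) \<le> (\<Sum>z\<in>Z. prob (B4 z))"
      using Z sets by (intro finite_measure_subadditive_finite) auto
    also have "\<dots> \<le> card Z * p4"
      using p4 by (intro sum_bounded_above) (simp add: B4_def)
    finally show "prob (\<Union>z\<in>Z. B4 z) \<le> card Z * p4" .
  qed
  finally have "prob B \<le> p1 + (card U * p2 + (card U * card Z * p3 + card Z * p4))" .
  moreover have "1 - prob B = prob (space P - B)"
    unfolding B_def using sets U(1) W(1) Z(1)
    by (intro prob_compl[symmetric] sets.Un sets.finite_UN) auto
  moreover have "prob (space P - B) \<le> prob (good_event P X b c)"
    using sub good_event_measurable[OF pp fin] by (intro finite_measure_mono) (auto simp: good_event_def)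
  ultimately show ?thesis by linarith
qed


text \<open>Here \<open>a / n\<close> is the scale of all changes of radius, small enough to alter
  volumes by a factor close to 1. The value \<open>\<kappa>\<close> makes the term
  \<open>\<kappa> * L * ln (8 / \<delta>)\<close> of the lower tail equal to
  \<open>\<delta> / 8 * L\<close>; \<open>D\<close> makes \<open>\<kappa> * D\<close> equal to 4;
  \<open>t\<close> makes the difference of balls fit into a ball of radius \<open>1 - D / n\<close>.
  The constants \<open>cU\<close> and \<open>cZ\<close> come from the sizes of the nets, and
  \<open>c1\<close> is the rate of the total count.\<close>

lemma good_event_prob_ge:
  fixes \<delta> M a \<kappa> D t c1 cU cZ L :: real
  assumes \<delta>: "0 < \<delta>" "\<delta> < 1" and M: "0 < M"
    and vol: "emeasure TM (torus n \<Lambda>) \<le> ennreal (M ^ n * nu n)"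
    and pp: "poisson_process P TM ((1/2 + \<delta>) * (real n * ln (real n) / nu n)) X"
    and a: "a = \<delta> / 3"
    and \<kappa>: "\<kappa> = (\<delta> / 8) / ln (8 / \<delta>)"
    and D: "D = 4 / \<kappa>"
    and t: "t = 8 * D / a"
    and n: "2 \<le> n" "D < real n"
    and c1: "c1 = (1/2 + 2 * \<delta>) * ln ((1/2 + 2 * \<delta>) / (1/2 + \<delta>)) - \<delta>"
    and cU: "cU = ln (4 * M * sqrt ((1 + t) / a))"
    and cZ: "cZ = ln (4 * M / a)"
    and L: "L = real n * ln (real n)"
  shows "1 - (exp (- c1 * L) + exp (n * cU - \<delta> / 4 * L) + exp (n * (cU + cZ) - L) + exp (n * cZ - \<delta> * L))
    \<le> measure P (good_event P X ((1/2 + 2 * \<delta>) * L) ((xi + 10 * \<delta>) * L))"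
proof -
  have n0: "real n > 0" using n by simp
  have L0: "0 < L" using n by (simp add: L)
  define \<rho> where "\<rho> = (1/2 + \<delta>) * (L / nu n)"
  have \<rho>0: "0 \<le> \<rho>" using L0 nu_pos[of n] \<delta> by (simp add: \<rho>_def)
  have pp': "poisson_process P TM \<rho> X" using pp by (simp add: \<rho>_def L)
  have a0: "0 < a" "a < 1 / 3" using \<delta> by (simp_all add: a)
  have "1 < 8 / \<delta>" using \<delta> by (simp add: field_simps)
  then have ln8: "0 < ln (8 / \<delta>)" by (rule ln_gt_zero)
  have \<kappa>0: "0 < \<kappa>" using \<delta> ln8 by (simp add: \<kappa>)
  have D0: "0 < D" using \<kappa>0 by (simp add: D)
  have t0: "0 < t" using D0 a0 by (simp add: t)
  define r where "r = 1 - a / n"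
  define r' where "r' = 1 - a / (2 * n)"
  define s where "s = a / (2 * n)"
  define e where "e = sqrt (a / (4 * n * (1 + t)))"
  define q where "q = 1 - D / n"
  have an: "a / n < 1 / 3" "0 < a / n" using a0 n by (simp_all add: field_simps)
  define y where "y = a / n"
  have half: "a / (2 * n) = y / 2" by (simp add: y_def)
  have r: "0 < r" "r \<le> 2" "r \<le> 1" using an unfolding r_def by linarith+
  have r2: "r\<^sup>2 \<le> 1" using r by (intro power_le_one) auto
  have r': "0 \<le> r'" using an[folded y_def] unfolding r'_def half by linarith
  have s: "0 < s" "s \<le> 1" using an[folded y_def] unfolding s_def half by linarith+
  have q: "0 < q" "q \<le> 2" using n n0 D0 by (auto simp: q_def field_simps)
  have e2: "e\<^sup>2 = a / (4 * n * (1 + t))"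
    unfolding e_def using a0 t0 by (intro real_sqrt_pow2) simp
  have e: "0 < e" "e \<le> 4"
  proof -
    show "0 < e" using a0 t0 n0 by (simp add: e_def)
    have "1 * 1 \<le> 4 * real n * (1 + t)" using n t0 by (intro mult_mono) auto
    then have "a / (4 * n * (1 + t)) \<le> 1" using a0 by (subst divide_le_eq_1_pos) auto
    then have "e \<le> sqrt 1" unfolding e_def by (rule real_sqrt_le_mono)
    then show "e \<le> 4" by simp
  qed
  \<comment> \<open>The inequality \<open>r'\<^sup>2 - r\<^sup>2 \<ge> a / (2 * n)\<close> gains
    \<open>t * a / (2 * n)\<close>, and \<open>e\<close> is chosen to lose only half of it. The
    remaining half is \<open>2 * D / n\<close> by the choice of \<open>t\<close>, and
    \<open>1 - 2 * D / n\<close> is at most the square of \<open>1 - D / n\<close>.\<close>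
  have geom: "(1 + t) * r\<^sup>2 + t * (1 + t) * e\<^sup>2 - t * r'\<^sup>2 \<le> q\<^sup>2"
  proof -
    have "w * (a / (4 * n * w)) = a / (4 * n)" if "0 < w" for w :: real
      using that by simp
    from this[of "1 + t"] have "t * (1 + t) * e\<^sup>2 = t * (a / (4 * n))"
      using t0 unfolding e2 by (simp only: mult.assoc)
    moreover have "a / (2 * n) \<le> r'\<^sup>2 - r\<^sup>2"
    proof -
      have "r'\<^sup>2 - r\<^sup>2 = (r' - r) * (r' + r)" by (simp add: power2_eq_square algebra_simps)
      also have "r' - r = a / (2 * n)" by (simp add: r'_def r_def)
      finally have "r'\<^sup>2 - r\<^sup>2 = a / (2 * n) * (r' + r)" .
      moreover have "1 \<le> r' + r" using an[folded y_def] unfolding r'_def r_def half y_def[symmetric] by linarith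
      ultimately show ?thesis
        using mult_left_mono[of 1 "r' + r" "a / (2 * n)"] a0 by simp
    qed
    then have "t * (a / (2 * n)) \<le> t * (r'\<^sup>2 - r\<^sup>2)" using t0 by (intro mult_left_mono) auto
    ultimately have "(1 + t) * r\<^sup>2 + t * (1 + t) * e\<^sup>2 - t * r'\<^sup>2
        \<le> r\<^sup>2 - (t * (a / (2 * n)) - t * (a / (4 * n)))"
      by (simp add: algebra_simps)
    also have "\<dots> \<le> 1 - (t * (a / (2 * n)) - t * (a / (4 * n)))"
      using r2 by simp
    also have "\<dots> = 1 - 2 * (D / n)"
      using a0 n0 by (simp add: t field_simps)
    also have "\<dots> \<le> 1 - 2 * (D / n) + (D / n)\<^sup>2"
      by simp
    also have "\<dots> = q\<^sup>2"
      by (simp add: q_def power2_eq_square algebra_simps)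
    finally show ?thesis .
  qed
  have fin: "emeasure TM (torus n \<Lambda>) \<noteq> \<infinity>"
    using vol by (auto simp: top_unique)
  define V where "V = measure TM (torus n \<Lambda>) / nu n"
  have V: "1 \<le> V"
  proof -
    have "emeasure TM (torus n \<Lambda>) = ennreal (measure TM (torus n \<Lambda>))"
      using fin by (simp add: emeasure_eq_ennreal_measure)
    then have "nu n \<le> measure TM (torus n \<Lambda>)"
      using nu_le_emeasure_torus by (simp add: ennreal_le_iff)
    then show ?thesis using nu_pos[of n] by (simp add: V_def)
  qed
  have MV: "0 \<le> M ^ n * nu n" using M nu_pos[of n] by simp
  obtain U where U: "finite U" "U \<subseteq> Rn n" "real (card U) * (nu n * (e / 2) ^ n) \<le> M ^ n * nu n"
    "\<And>y. y \<in> Rn n \<Longrightarrow> \<exists>z\<in>U. tproj n \<Lambda> z \<in> tball y e"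
    by (rule torus_net[OF vol MV e], rule that)
  have s4: "s \<le> 4" using s(2) by simp
  obtain Z where Z: "finite Z" "Z \<subseteq> Rn n" "real (card Z) * (nu n * (s / 2) ^ n) \<le> M ^ n * nu n"
    "\<And>y. y \<in> Rn n \<Longrightarrow> \<exists>z\<in>Z. tproj n \<Lambda> z \<in> tball y s"
    by (rule torus_net[OF vol MV s(1) s4], rule that)
  have card_le: "real k \<le> (2 * M / x) ^ n" if "0 < x" "real k * (nu n * (x / 2) ^ n) \<le> M ^ n * nu n" for k x
  proof -
    have "nu n * (real k * (x / 2) ^ n) \<le> nu n * M ^ n" using that(2) by (simp add: mult_ac)
    then have "real k * (x / 2) ^ n \<le> M ^ n" using nu_pos[of n] by simp
    then have "real k \<le> M ^ n / (x / 2) ^ n" using that(1) by (simp add: pos_le_divide_eq)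
    also have "\<dots> = (2 * M / x) ^ n" by (simp add: power_divide power_mult_distrib)
    finally show ?thesis .
  qed
  have card_Z: "real (card Z) \<le> exp (L + n * cZ)"
  proof -
    have pos: "0 < 4 * M / a" using M a0 by simp
    have "real (card Z) \<le> (2 * M / s) ^ n" using card_le[OF s(1) Z(3)] .
    also have "2 * M / s = real n * (4 * M / a)" by (simp add: s_def)
    also have "\<dots> = exp (ln (real n) + cZ)" using n0 pos by (simp add: exp_add cZ)
    also have "\<dots> ^ n = exp (L + n * cZ)" by (simp add: exp_of_nat_mult[symmetric] L algebra_simps)
    finally show ?thesis .
  qed
  have card_U: "real (card U) \<le> exp (L / 2 + n * cU)"
  proof -
    have pos: "0 < 4 * M * sqrt ((1 + t) / a)" using M a0 t0 by simp
    have "real (card U) \<le> (2 * M / e) ^ n" using card_le[OF e(1) U(3)] .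
    also have "2 * M / e = sqrt (real n) * (4 * M * sqrt ((1 + t) / a))"
      by (simp add: e_def real_sqrt_divide real_sqrt_mult)
    also have "sqrt (real n) = exp (ln (real n) / 2)" using n0 by (simp add: ln_sqrt[symmetric])
    also have "exp (ln (real n) / 2) * (4 * M * sqrt ((1 + t) / a)) = exp (ln (real n) / 2 + cU)"
      using pos by (simp add: exp_add cU)
    also have "\<dots> ^ n = exp (L / 2 + n * cU)" by (simp add: exp_of_nat_mult[symmetric] L algebra_simps)
    finally show ?thesis .
  qed
  \<comment> \<open>The exponents beat the net sizes: up to factors \<open>exp (O(n))\<close> there
    are \<open>exp (L / 2)\<close> points in \<open>U\<close>, \<open>exp (3 / 2 * L)\<close> pairs
    and \<open>exp L\<close> points in \<open>Z\<close>, which leaves decay rates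
    \<open>\<delta> / 4\<close>, 1 and \<open>\<delta>\<close>.\<close>
  define p1 where "p1 = exp (- c1 * L)"
  define p2 where "p2 = exp (- (1 / 2 + \<delta> / 4) * L)"
  define p3 where "p3 = exp (- (5 / 2) * L)"
  define p4 where "p4 = exp (- (1 + \<delta>) * L)"
  let ?b = "(1/2 + 2 * \<delta>) * L" and ?c = "(xi + 10 * \<delta>) * L"
  have "1 - (p1 + card U * p2 + card U * card Z * p3 + card Z * p4) \<le> measure P (good_event P X ?b ?c)"
  proof (rule good_event_union_bound[OF pp' fin U(1,2,4) Z(1,2,4), where r' = r' and r = r and k = "\<kappa> * L"])
    show "s + r' \<le> 1" by (simp add: s_def r'_def)
    show "0 \<le> ?b" using L0 \<delta> by simp
    show "0 \<le> p3" by (simp add: p3_def)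
    show "measure P {\<omega> \<in> space P. \<not> ecount (X \<omega> \<inter> torus n \<Lambda>)
        \<le> ennreal (?b * (measure TM (torus n \<Lambda>) / nu n))} \<le> p1"
    proof -
      \<comment> \<open>The ratio of threshold to mean is the optimal Chernoff parameter. The
        exponent becomes \<open>- c1 * L * V\<close>, where \<open>V\<close> may be dropped because
        \<open>V \<ge> 1\<close> and \<open>c1 \<ge> 0\<close>.\<close>
      define \<theta> where "\<theta> = (1/2 + 2 * \<delta>) / (1/2 + \<delta>)"
      have \<theta>: "1 \<le> \<theta>" using \<delta> by (simp add: \<theta>_def)
      have "\<theta> - 1 = \<delta> / (1/2 + \<delta>)" using \<delta> by (simp add: \<theta>_def field_simps)
      then have m: "(1/2 + \<delta>) * (\<theta> - 1) = \<delta>" using \<delta> by simp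
      have "ln (1 / \<theta>) \<le> 1 / \<theta> - 1" using \<theta> by (intro ln_le_minus_one) simp
      then have "1 - 1 / \<theta> \<le> ln \<theta>" using \<theta> by (simp add: ln_div)
      then have "(1/2 + 2 * \<delta>) * (1 - 1 / \<theta>) \<le> (1/2 + 2 * \<delta>) * ln \<theta>" using \<delta> by (intro mult_left_mono) auto
      moreover have "(1/2 + 2 * \<delta>) * (1 - 1 / \<theta>) = \<delta>" using \<delta> by (simp add: \<theta>_def field_simps)
      ultimately have c1_0: "0 \<le> c1" by (simp add: c1 \<theta>_def)
      have "measure P {\<omega> \<in> space P. \<not> ecount (X \<omega> \<inter> torus n \<Lambda>) \<le> ennreal (?b * V)}
          \<le> exp ((1/2 + \<delta>) * L * V * (\<theta> - 1) - ?b * V * ln \<theta>)"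
      proof (rule poisson_process_upper_tail[OF pp' _ \<theta> _ \<rho>0])
        show "torus n \<Lambda> \<in> sets TM" using sets.top[of TM] by simp
        show "0 \<le> ?b * V" using L0 \<delta> V by (intro mult_nonneg_nonneg) auto
      qed (simp add: \<rho>_def V_def)
      also have "(1/2 + \<delta>) * L * V * (\<theta> - 1) - ?b * V * ln \<theta>
          = L * V * ((1/2 + \<delta>) * (\<theta> - 1)) - L * V * ((1/2 + 2 * \<delta>) * ln \<theta>)"
        by (simp add: mult_ac)
      also have "\<dots> = - (c1 * (L * V))" unfolding m by (simp add: c1 \<theta>_def algebra_simps)
      also have "\<dots> \<le> - c1 * L"
        using mult_left_mono[of 1 V "c1 * L"] V c1_0 L0 by (simp add: mult_ac)
      finally show ?thesis unfolding p1_def V_def by simp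
    qed
    show "measure P {\<omega> \<in> space P. ecount (X \<omega> \<inter> tball u r) \<le> ennreal (\<kappa> * L)} \<le> p2" if "u \<in> U" for u
    proof -
      have rn: "1 - a \<le> r ^ n"
        using Bernoulli_inequality[of "- (a / n)" n] an n0 by (simp add: r_def)
      have "1/2 + \<delta>/2 \<le> (1/2 + \<delta>) * (1 - a)"
      proof -
        have "\<delta> * \<delta> \<le> \<delta> * 1" using \<delta> by (intro mult_left_mono) auto
        then show ?thesis unfolding a by (simp add: field_simps)
      qed
      also have "\<dots> \<le> (1/2 + \<delta>) * r ^ n" using rn \<delta> by (intro mult_left_mono) auto
      finally have "L * (1/2 + \<delta>/2) \<le> L * ((1/2 + \<delta>) * r ^ n)" using L0 by (intro mult_left_mono) auto
      then have "(1/2 + \<delta>/2) * L \<le> \<rho> * measure TM (tball u r)"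
        using nu_pos[of n] r by (simp add: measure_tball \<rho>_def mult_ac)
      \<comment> \<open>With parameter \<open>\<delta> / 8\<close> the exponent is close to minus
        the mean: of the surplus \<open>\<delta> / 2\<close> in the mean, at most
        \<open>\<delta> / 4\<close> is lost, using
        \<open>\<delta> * \<delta> \<le> \<delta>\<close>.\<close>
      then have "measure P {\<omega> \<in> space P. ecount (X \<omega> \<inter> tball u r) \<le> ennreal (\<kappa> * L)}
          \<le> exp ((1/2 + \<delta>/2) * L * (\<delta> / 8 - 1) - \<kappa> * L * ln (\<delta> / 8))"
        using \<delta> L0 \<kappa>0 by (intro poisson_process_lower_tail[OF pp' tball_measurable _ _ _ \<rho>0]) auto
      also have "(1/2 + \<delta>/2) * L * (\<delta> / 8 - 1) - \<kappa> * L * ln (\<delta> / 8)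
          = L * ((1/2 + \<delta>/2) * (\<delta> / 8 - 1) + \<delta> / 8)"
      proof -
        have "ln (\<delta> / 8) = - ln (8 / \<delta>)" using \<delta> by (simp add: ln_div)
        then have "\<kappa> * ln (\<delta> / 8) = - (\<delta> / 8)" using ln8 by (simp add: \<kappa>)
        then have "\<kappa> * L * ln (\<delta> / 8) = L * (- (\<delta> / 8))" by (simp add: mult_ac)
        then show ?thesis by (simp add: algebra_simps)
      qed
      also have "\<dots> \<le> L * (- (1 / 2 + \<delta> / 4))"
      proof -
        have "\<delta> * \<delta> \<le> \<delta> * 1" using \<delta> by (intro mult_left_mono) auto
        then show ?thesis using L0 by (intro mult_left_mono) (auto simp: field_simps)
      qed
      finally show ?thesis unfolding p2_def by (simp add: mult_ac)
    qed
    show "measure P {\<omega> \<in> space P. \<not> ecount (X \<omega> \<inter> (tball u r - tball z r')) \<le> ennreal (\<kappa> * L)} \<le> p3"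
      if uz: "u \<in> U" "z \<in> Z" "tproj n \<Lambda> z \<in> tball u e" for u z
    proof -
      obtain w where w: "tball u r - tball z r' \<subseteq> tball w q"
        using tball_diff_subset[OF less_imp_le[OF t0] less_imp_le[OF q(1)] r' _ uz(3) geom] uz(2) Z(2) by blast
      have qn: "q ^ n \<le> exp (- D)"
      proof -
        have "q \<le> exp (- (D / n))" using exp_ge_add_one_self[of "- (D / n)"] by (simp add: q_def)
        then have "q ^ n \<le> exp (- (D / n)) ^ n" using q by (intro power_mono) auto
        also have "\<dots> = exp (- D)" using n0 by (simp add: exp_of_nat_mult[symmetric])
        finally show ?thesis .
      qed
      have "measure TM (tball u r - tball z r') \<le> measure TM (tball w q)"
        using w emeasure_tball[OF q, of w] by (intro measure_mono_fmeasurable) (auto simp: fmeasurable_def)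
      also have "\<dots> \<le> nu n * exp (- D)"
        using qn nu_pos[of n] q by (simp add: measure_tball)
      finally have "\<rho> * measure TM (tball u r - tball z r') \<le> \<rho> * (nu n * exp (- D))"
        using \<rho>0 by (intro mult_left_mono)
      also have "\<dots> = (1/2 + \<delta>) * L * exp (- D)"
        using nu_pos[of n] by (simp add: \<rho>_def)
      \<comment> \<open>With parameter \<open>exp D\<close> the small mean grows back to at most
        \<open>3 / 2 * L\<close>, while the threshold contributes
        \<open>\<kappa> * L * D = 4 * L\<close>.\<close>
      finally have "measure P {\<omega> \<in> space P. \<not> ecount (X \<omega> \<inter> (tball u r - tball z r')) \<le> ennreal (\<kappa> * L)}
          \<le> exp ((1/2 + \<delta>) * L * exp (- D) * (exp D - 1) - \<kappa> * L * ln (exp D))"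
        using L0 \<kappa>0 D0 by (intro poisson_process_upper_tail[OF pp' _ _ _ \<rho>0]) auto
      also have "(1/2 + \<delta>) * L * exp (- D) * (exp D - 1) - \<kappa> * L * ln (exp D)
          = (1/2 + \<delta>) * L * (1 - exp (- D)) - 4 * L"
      proof -
        have "exp (- D) * (exp D - 1) = 1 - exp (- D)" by (simp add: exp_minus algebra_simps)
        moreover have "\<kappa> * L * ln (exp D) = 4 * L" using \<kappa>0 by (simp add: D)
        ultimately show ?thesis by (simp only: mult.assoc)
      qed
      also have "\<dots> \<le> - (5 / 2) * L"
      proof -
        have "(1/2 + \<delta>) * L * (1 - exp (- D)) \<le> (3/2) * L * 1"
          using \<delta> L0 D0 by (intro mult_mono) auto
        then show ?thesis by simp
      qed
      finally show ?thesis unfolding p3_def by simp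
    qed
    show "measure P {\<omega> \<in> space P. \<not> ecount (X \<omega> \<inter> tball z (1 + s)) \<le> ennreal ?c} \<le> p4" if "z \<in> Z" for z
    proof -
      have xi: "1 \<le> xi" "xi \<le> 2"
        by (rule order_trans[OF _ xi_bounds(1)], simp)
          (rule order_trans[OF less_imp_le[OF xi_bounds(2)]], simp)
      have "xi > 0 \<and> ln (2 * xi / exp 1) = 1 / (2 * xi)"
        unfolding xi_def by (rule theI'[OF xi_ex1])
      then have ln_xi: "xi * ln (2 * xi) = xi + 1 / 2" "ln (2 * xi) = 1 + 1 / (2 * xi)"
        using xi by (simp_all add: ln_div field_simps)
      \<comment> \<open>Enlarging the radius by \<open>s\<close> multiplies the volume by at most
        \<open>exp (a / 2) \<le> 1 + a\<close>, which raises the intensity from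
        \<open>1/2 + \<delta>\<close> to at most \<open>1/2 + 2 * \<delta>\<close>.\<close>
      have "(1 + s) ^ n \<le> exp s ^ n" using s by (intro power_mono exp_ge_add_one_self) auto
      also have "\<dots> = exp (a / 2)" using n0 by (simp add: s_def exp_of_nat_mult[symmetric])
      also have "\<dots> \<le> 1 + a" using exp_bound_lemma[of "a / 2"] a0 by simp
      finally have "(1/2 + \<delta>) * (1 + s) ^ n \<le> (1/2 + \<delta>) * (1 + a)"
        using \<delta> by (intro mult_left_mono) auto
      also have "\<dots> \<le> 1/2 + 2 * \<delta>"
      proof -
        have "\<delta> * \<delta> \<le> \<delta> * 1" using \<delta> by (intro mult_left_mono) auto
        moreover have "(1/2 + \<delta>) * (1 + a) = 1/2 + \<delta> + \<delta> / 6 + \<delta> * \<delta> / 3"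
          unfolding a by (simp add: field_simps)
        ultimately show ?thesis using \<delta> by linarith
      qed
      finally have "L * ((1/2 + \<delta>) * (1 + s) ^ n) \<le> L * (1/2 + 2 * \<delta>)"
        using L0 by (intro mult_left_mono) auto
      then have "\<rho> * measure TM (tball z (1 + s)) \<le> (1/2 + 2 * \<delta>) * L"
        using nu_pos[of n] s by (simp add: measure_tball \<rho>_def mult_ac)
      then have "measure P {\<omega> \<in> space P. \<not> ecount (X \<omega> \<inter> tball z (1 + s)) \<le> ennreal ?c}
          \<le> exp ((1/2 + 2 * \<delta>) * L * (2 * xi - 1) - ?c * ln (2 * xi))"
        using xi \<delta> L0 by (intro poisson_process_upper_tail[OF pp' tball_measurable _ _ \<rho>0]) auto
      also have "(1/2 + 2 * \<delta>) * L * (2 * xi - 1) - ?c * ln (2 * xi)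
          = L * (- 1 + \<delta> * (4 * xi - 2 - 10 * ln (2 * xi)))"
      proof -
        have "?c * ln (2 * xi) = L * (xi * ln (2 * xi)) + L * (10 * \<delta> * ln (2 * xi))"
          by (simp add: algebra_simps)
        then show ?thesis unfolding ln_xi(1) by (simp add: algebra_simps)
      qed
      \<comment> \<open>The equation for \<open>xi\<close> has produced the main term
        \<open>- 1\<close>. The slack \<open>10 * \<delta>\<close> in the threshold outweighs the
        excess \<open>2 * \<delta>\<close> in the intensity, because
        \<open>ln (2 * xi) \<ge> 1\<close> and \<open>xi \<le> 2\<close>.\<close>
      also have "\<dots> \<le> L * (- 1 + \<delta> * (- 1))"
      proof -
        have "1 \<le> ln (2 * xi)" using xi unfolding ln_xi(2) by simp
        then have "4 * xi - 2 - 10 * ln (2 * xi) \<le> - 1" using xi(2) by linarith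
        then show ?thesis using L0 \<delta> by (intro mult_left_mono add_left_mono) auto
      qed
      finally show ?thesis unfolding p4_def by (simp add: algebra_simps)
    qed
  qed
  moreover have "p1 = exp (- c1 * L)" by (simp add: p1_def)
  moreover have "card U * p2 \<le> exp (n * cU - \<delta> / 4 * L)"
  proof -
    have "card U * p2 \<le> exp (L / 2 + n * cU) * p2"
      using card_U by (intro mult_right_mono) (simp_all add: p2_def)
    also have "\<dots> = exp (n * cU - \<delta> / 4 * L)" by (simp add: p2_def mult_exp_exp algebra_simps)
    finally show ?thesis .
  qed
  moreover have "card U * card Z * p3 \<le> exp (n * (cU + cZ) - L)"
  proof -
    have "card U * card Z * p3 \<le> (exp (L / 2 + n * cU) * exp (L + n * cZ)) * p3"
      using mult_mono[OF card_U card_Z] by (intro mult_right_mono) (simp_all add: p3_def)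
    also have "\<dots> = exp (n * (cU + cZ) - L)" by (simp add: p3_def mult_exp_exp algebra_simps)
    finally show ?thesis .
  qed
  moreover have "card Z * p4 \<le> exp (n * cZ - \<delta> * L)"
  proof -
    have "card Z * p4 \<le> exp (L + n * cZ) * p4"
      using card_Z by (intro mult_right_mono) (simp_all add: p4_def)
    also have "\<dots> = exp (n * cZ - \<delta> * L)" by (simp add: p4_def mult_exp_exp algebra_simps)
    finally show ?thesis .
  qed
  ultimately show ?thesis by linarith
qed

end

section \<open>Passage to the limit\<close>

lemma exp_nlogn_tendsto_0:
  fixes c C :: real
  assumes "0 < c"
  shows "(\<lambda>n. exp (real n * C - c * (real n * ln (real n)))) \<longlonglongrightarrow> 0"
proof -
  \<comment> \<open>Factoring out \<open>n\<close> leaves \<open>c * ln n - C\<close>, which tends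
    to infinity whatever \<open>C\<close> is.\<close>
  have "filterlim (\<lambda>n. real n * (c * ln (real n) - C)) at_top sequentially"
  proof (rule filterlim_at_top_mult_at_top[OF filterlim_real_sequentially])
    have "filterlim (\<lambda>n. ln (real n)) at_top sequentially" by real_asymp
    then have "filterlim (\<lambda>n. c * ln (real n)) at_top sequentially"
      using assms by (intro filterlim_tendsto_pos_mult_at_top[OF tendsto_const])
    then have "filterlim (\<lambda>n. - C + c * ln (real n)) at_top sequentially"
      by (intro filterlim_tendsto_add_at_top[OF tendsto_const])
    then show "filterlim (\<lambda>n. c * ln (real n) - C) at_top sequentially"
      by simp
  qed
  then have "((\<lambda>n. exp (- (real n * (c * ln (real n) - C)))) \<longlongrightarrow> 0) sequentially"
    by (intro filterlim_compose[OF exp_at_bot] filterlim_compose[OF filterlim_uminus_at_bot_at_top])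
  then show ?thesis by (simp add: algebra_simps)
qed

theorem theorem1p2:
  fixes \<delta> M :: real
    and \<Lambda> :: "nat \<Rightarrow> nvec set"
    and P :: "nat \<Rightarrow> 'w measure"
    and X :: "nat \<Rightarrow> 'w \<Rightarrow> nvec set set"
  assumes "0 < \<delta>" and "\<delta> < 1" and "M > 0"
    and "\<And>n. n \<ge> 1 \<Longrightarrow> packing_lattice n (nball n 2) (\<Lambda> n)"
    and "\<And>n. n \<ge> 1 \<Longrightarrow>
           emeasure (torus_measure n (\<Lambda> n)) (torus n (\<Lambda> n)) \<le> ennreal (M ^ n * nu n)"
    and "\<And>n. n \<ge> 1 \<Longrightarrow>
           poisson_process (P n) (torus_measure n (\<Lambda> n))
             ((1/2 + \<delta>) * (real n * ln (real n) / nu n)) (X n)"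
  shows "(\<lambda>n. measure (P n)
            {\<omega> \<in> space (P n).
               torus n (\<Lambda> n) \<subseteq> tsum n (\<Lambda> n) (X n \<omega>) (nball n 1) \<and>
               cover_density n (\<Lambda> n) (X n \<omega>)
                 \<le> ennreal ((1/2 + 2 * \<delta>) * real n * ln (real n)) \<and>
               max_mult n (\<Lambda> n) (X n \<omega>)
                 \<le> ennreal ((xi + 10 * \<delta>) * real n * ln (real n))})
         \<longlonglongrightarrow> 1"
    (is "(\<lambda>n. ?p n) \<longlonglongrightarrow> 1")
proof -
  define a \<kappa> where "a = \<delta> / 3" and "\<kappa> = (\<delta> / 8) / ln (8 / \<delta>)"
  define D where "D = 4 / \<kappa>"
  define t where "t = 8 * D / a"
  define c1 where "c1 = (1/2 + 2 * \<delta>) * ln ((1/2 + 2 * \<delta>) / (1/2 + \<delta>)) - \<delta>"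
  define cU cZ where "cU = ln (4 * M * sqrt ((1 + t) / a))" and "cZ = ln (4 * M / a)"
  \<comment> \<open>The factors 0 and 1 bring every summand into the form of
    \<open>exp_nlogn_tendsto_0\<close>.\<close>
  define err where "err n = exp (real n * 0 - c1 * (real n * ln (real n)))
    + exp (real n * cU - \<delta> / 4 * (real n * ln (real n)))
    + exp (real n * (cU + cZ) - 1 * (real n * ln (real n)))
    + exp (real n * cZ - \<delta> * (real n * ln (real n)))" for n :: nat
  have c1: "0 < c1"
  proof -
    define \<theta> where "\<theta> = (1/2 + 2 * \<delta>) / (1/2 + \<delta>)"
    have \<theta>: "1 < \<theta>" using assms(1) by (simp add: \<theta>_def)
    \<comment> \<open>The inequality \<open>ln x \<le> x - 1\<close> is strict away from
      \<open>x = 1\<close>; this makes the rate \<open>c1\<close> positive, as the limit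
      requires.\<close>
    have "ln (1 / \<theta>) < 1 / \<theta> - 1" using \<theta> ln_eq_minus_one[of "1 / \<theta>"] ln_le_minus_one[of "1 / \<theta>"] by force
    then have "1 - 1 / \<theta> < ln \<theta>" using \<theta> by (simp add: ln_div)
    then have "(1/2 + 2 * \<delta>) * (1 - 1 / \<theta>) < (1/2 + 2 * \<delta>) * ln \<theta>"
      using assms(1) by (intro mult_strict_left_mono) auto
    moreover have "(1/2 + 2 * \<delta>) * (1 - 1 / \<theta>) = \<delta>" using assms(1) by (simp add: \<theta>_def field_simps)
    ultimately show ?thesis by (simp add: c1_def \<theta>_def)
  qed
  have err: "(\<lambda>n. 1 - err n) \<longlonglongrightarrow> 1 - (0 + 0 + 0 + 0)"
    unfolding err_def using c1 assms(1)
    by (intro tendsto_diff tendsto_add tendsto_const exp_nlogn_tendsto_0) auto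
  have lower: "1 - err n \<le> ?p n" if n: "2 \<le> n" "D < real n" for n
  proof -
    interpret ball_packing_torus n "\<Lambda> n"
      using assms(4)[of n] n by unfold_locales simp
    note vol = assms(5)[of n, OF order.trans[OF one_le_numeral n(1)]]
      and pp = assms(6)[of n, OF order.trans[OF one_le_numeral n(1)]]
    have "1 - err n \<le> measure (P n) (good_event (P n) (X n)
        ((1/2 + 2 * \<delta>) * (real n * ln (real n))) ((xi + 10 * \<delta>) * (real n * ln (real n))))"
      using good_event_prob_ge[OF assms(1-3) vol pp a_def \<kappa>_def D_def t_def n
          c1_def cU_def cZ_def refl] by (simp add: err_def)
    then show ?thesis by (simp add: good_event_def mult.assoc)
  qed
  obtain N :: nat where N: "D < real N" using reals_Archimedean2 by blast
  have ev: "eventually (\<lambda>n. 2 \<le> n \<and> D < real n) sequentially"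
    using eventually_ge_at_top[of "max 2 N"] by eventually_elim (use N in auto)
  show ?thesis
  proof (rule tendsto_sandwich)
    show "eventually (\<lambda>n. 1 - err n \<le> ?p n) sequentially"
      using ev by eventually_elim (use lower in blast)
    show "eventually (\<lambda>n. ?p n \<le> 1) sequentially"
      using ev
    proof eventually_elim
      case (elim n)
      then interpret prob_space "P n"
        using assms(6)[of n] by (simp add: poisson_process_def)
      show ?case by (rule prob_le_1)
    qed
    show "(\<lambda>n. 1 - err n) \<longlonglongrightarrow> 1" using err by simp
  qed (rule tendsto_const)
qed

end
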